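(* Let $n\ge 3$, let $\vec X=(X_1,\dots,X_n)$ be independent random variables uniformly distributed on $I=[0,1]$, and let $\vec Y=(Y_1,\dots,Y_n)$ be a binary rearrangement of $\vec X$ such that for some $k\in\{2,\dots,n\}$ the initial rank $\mathfrak R_k=1+\#\{i<k:Y_i>Y_k\}$ is independent of the random vector $(Y_1,\dots,Y_{k-1})$. Then $\vec Y$ is equal in distribution to some travellers' process: there is $\theta\in[0,1]$ such that $\vec Y$ and $\vec Y_\theta$ have the same distribution.
   Context: Almost total ordering of $I$: a binary relation $\prec$ on $I$ (a measurable subset of $I^2$) such that (completeness) the set of $(u,v)\in I^2$ with neither $u\prec v$ nor $v\prec u$ has measure zero; (antisymmetry) the set of $(u,v)\in I^2$ with both $u\prec v$ and $v\prec u$ has measure zero; (transitivity) for almost every $(u,v,w)\in I^3$ with $u\prec v$ and $v\prec w$, also $u\prec w$. Binary rearrangement: $\vec Y$ is a binary rearrangement of $\vec X$ if there is an almost total ordering $\prec$ of $I$ such that $\vec Y$ is equal in distribution to the sequence $(X_{\sigma_1},\dots,X_{\sigma_n})$, where $\sigma$ is the (almost surely unique) permutation for which $X_{\sigma_1}\prec X_{\sigma_2}\prec\dots\prec X_{\sigma_n}$ (i.e. $X_{\sigma_i}\prec X_{\sigma_j}$ whenever $i<j$). Travellers' process: for $\theta\in[0,1]$ let $f_\theta:I\to I$ be $f_\theta(x)=\frac{\theta-x}{\theta}$ for $0\le x\le\theta$ and $f_\theta(x)=\frac{x-\theta}{1-\theta}$ for $\theta\le x\le 1$ (for $\theta=0$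 only the second formula is used, so $f_0(x)=x$; for $\theta=1$ only the first, so $f_1(x)=1-x$). With probability one there is a unique permutation $\sigma=\sigma(\theta,\vec X)$ with $f_\theta(X_{\sigma_1})<\dots<f_\theta(X_{\sigma_n})$, and $\vec Y_\theta:=(X_{\sigma_1},\dots,X_{\sigma_n})$ for this $\sigma$. *)

theory Defs
  imports "HOL-Probability.Probability"
begin

text \<open>Vectors of length \<open>n\<close> are functions on the index set \<open>{1..n}\<close>, extended by
  \<^const>\<open>undefined\<close> outside it, i.e. elements of \<open>space (vec_space n)\<close>.\<close>

definition vec_space :: "nat \<Rightarrow> (nat \<Rightarrow> real) measure" where
  "vec_space n = PiM {1..n} (\<lambda>_. borel)"

text \<open>Measurability of the relation is Lebesgue measurability, the most general reading.\<close>

definition almost_total_ordering :: "(real \<times> real) set \<Rightarrow> bool" where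
  "almost_total_ordering R \<longleftrightarrow>
     R \<subseteq> {0..1} \<times> {0..1} \<and> R \<in> sets lebesgue \<and>
     {(u, v). u \<in> {0..1} \<and> v \<in> {0..1} \<and> (u, v) \<notin> R \<and> (v, u) \<notin> R} \<in> null_sets lebesgue \<and>
     {(u, v). u \<in> {0..1} \<and> v \<in> {0..1} \<and> (u, v) \<in> R \<and> (v, u) \<in> R} \<in> null_sets lebesgue \<and>
     (AE (u, v, w) in lborel. u \<in> {0..1} \<longrightarrow> v \<in> {0..1} \<longrightarrow> w \<in> {0..1} \<longrightarrow>
        (u, v) \<in> R \<longrightarrow> (v, w) \<in> R \<longrightarrow> (u, w) \<in> R)"

definition arranges :: "nat \<Rightarrow> (real \<times> real) set \<Rightarrow> (nat \<Rightarrow> real) \<Rightarrow> (nat \<Rightarrow> nat) \<Rightarrow> bool" where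
  "arranges n R x \<sigma> \<longleftrightarrow> \<sigma> permutes {1..n} \<and>
     (\<forall>i\<in>{1..n}. \<forall>j\<in>{1..n}. i < j \<longrightarrow> (x (\<sigma> i), x (\<sigma> j)) \<in> R)"

text \<open>The arranging permutation is only almost surely unique; the value \<^const>\<open>id\<close> in the
  exceptional case is a convention that affects a null event only.\<close>

definition arranging_perm :: "nat \<Rightarrow> (real \<times> real) set \<Rightarrow> (nat \<Rightarrow> real) \<Rightarrow> nat \<Rightarrow> nat" where
  "arranging_perm n R x =
     (if \<exists>!\<sigma>. arranges n R x \<sigma> then THE \<sigma>. arranges n R x \<sigma> else id)"

definition arrangement :: "nat \<Rightarrow> (real \<times> real) set \<Rightarrow> (nat \<Rightarrow> real) \<Rightarrow> nat \<Rightarrow> real" where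
  "arrangement n R x = (\<lambda>i\<in>{1..n}. x (arranging_perm n R x i))"

text \<open>\<open>Y\<close> may live on a probability space different from that of \<open>X\<close>. As the relation is only
  Lebesgue measurable, the rearranged vector is a random vector on the completion of \<open>M\<close>.\<close>

definition binary_rearrangement ::
  "'a measure \<Rightarrow> (nat \<Rightarrow> 'a \<Rightarrow> real) \<Rightarrow> 'b measure \<Rightarrow> (nat \<Rightarrow> 'b \<Rightarrow> real) \<Rightarrow> nat \<Rightarrow> bool" where
  "binary_rearrangement M X N Y n \<longleftrightarrow>
     (\<exists>R. almost_total_ordering R \<and>
        distr N (vec_space n) (\<lambda>\<omega>. \<lambda>i\<in>{1..n}. Y i \<omega>) =
        distr (completion M) (vec_space n) (\<lambda>\<omega>. arrangement n R (\<lambda>i. X i \<omega>)))"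

text \<open>The library's \<open>indep_var\<close> requires both variables to have the same value type; this is the
  same definition for different value types.\<close>

definition indep_rvs ::
  "'b measure \<Rightarrow> 'c measure \<Rightarrow> ('b \<Rightarrow> 'c) \<Rightarrow> 'd measure \<Rightarrow> ('b \<Rightarrow> 'd) \<Rightarrow> bool" where
  "indep_rvs N S f T g \<longleftrightarrow> f \<in> measurable N S \<and> g \<in> measurable N T \<and>
     prob_space.indep_set N {f -` A \<inter> space N | A. A \<in> sets S} {g -` B \<inter> space N | B. B \<in> sets T}"

definition initial_rank :: "(nat \<Rightarrow> 'b \<Rightarrow> real) \<Rightarrow> nat \<Rightarrow> 'b \<Rightarrow> nat" where
  "initial_rank Y k \<omega> = 1 + card {i \<in> {1..<k}. Y i \<omega> > Y k \<omega>}"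

text \<open>For \<open>\<theta> = 0\<close> only the second branch is used, and for \<open>\<theta> = 1\<close> only the first one
  applies to points of \<open>[0,1]\<close>; at \<open>x = \<theta>\<close> both branches give \<open>0\<close>.\<close>

definition travellers_map :: "real \<Rightarrow> real \<Rightarrow> real" where
  "travellers_map \<theta> x = (if \<theta> \<noteq> 0 \<and> x \<le> \<theta> then (\<theta> - x) / \<theta> else (x - \<theta>) / (1 - \<theta>))"

definition travellers_process ::
  "nat \<Rightarrow> real \<Rightarrow> (nat \<Rightarrow> 'a \<Rightarrow> real) \<Rightarrow> 'a \<Rightarrow> nat \<Rightarrow> real" where
  "travellers_process n \<theta> X \<omega> =
     arrangement n {(u, v). travellers_map \<theta> u < travellers_map \<theta> v} (\<lambda>i. X i \<omega>)"

end

theory Submission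
  imports Defs
begin

text \<open>
  A key \<open>\<phi> u\<close>, the mass of the predecessors of \<open>u\<close>, turns an almost total ordering into the
  comparison of keys without ties, so \<open>Y\<close> has density \<open>n!\<close> on the tuples with increasing keys.
  Given \<open>Y\<^sub>1, \<dots>, Y\<^sub>k\<^sub>-\<^sub>1\<close>, the law of \<open>Y\<^sub>k\<close> depends only on the key of \<open>Y\<^sub>k\<^sub>-\<^sub>1\<close>: it has a
  density proportional to a positive function \<open>w\<close> of the key on the points with larger key.
  When \<open>Y\<^sub>1, \<dots>, Y\<^sub>k\<^sub>-\<^sub>1\<close> all fall into a very short interval, \<open>Y\<^sub>k\<close> is unlikely to land between them,
  so independence makes this probability vanish altogether. What remains is that, for almost every
  \<open>y\<close>, a fixed fraction \<open>c\<close> of the \<open>w\<close>-mass with key above \<open>\<phi> y\<close> lies to the left of \<open>y\<close>.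

  Let \<open>\<theta>\<close> be the \<open>c\<close>-quantile of the \<open>w\<close>-mass, \<open>h x = (of_bool (x \<le> \<theta>) - c) * w (\<phi> x)\<close> and
  \<open>D t\<close> the integral of \<open>h\<close> over the keys above \<open>t\<close>. The fraction property gives
  \<open>h y * D (\<phi> y) \<ge> 0\<close>, while \<open>2 * \<integral>h y * D (\<phi> y) = (\<integral>h)\<^sup>2 = 0\<close>; hence \<open>D\<close> vanishes, the
  key is independent of the side of \<open>\<theta>\<close>, and \<open>\<theta> = c\<close>. Comparing with the fraction property, no
  point between \<open>y\<close> and \<open>\<theta>\<close> has a larger key than \<open>y\<close>, and this determines the mass of larger
  keys as \<open>1 - f\<^sub>\<theta> y\<close>.
\<close>

subsection \<open>Representation of an almost total ordering by a key\<close>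

lemma (in prob_space) AE_swap:
  assumes "Measurable.pred (M \<Otimes>\<^sub>M M) (\<lambda>z. P (fst z) (snd z))" "AE x in M. AE y in M. P x y"
  shows "AE y in M. AE x in M. P x y"
proof -
  interpret pair_sigma_finite M M ..
  show ?thesis
    using assms AE_commute[of P] by (simp add: pred_def)
qed

text \<open>Grouping the last two variables into a pair allows a quantifier to be moved past both of
  them by Fubini for two factors.\<close>

lemma (in prob_space) AE_triple_iff:
  assumes [measurable]: "Measurable.pred (M \<Otimes>\<^sub>M (M \<Otimes>\<^sub>M M)) (\<lambda>z. P (fst z) (fst (snd z)) (snd (snd z)))"
  shows "(AE x in M. AE y in M. AE z in M. P x y z) \<longleftrightarrow>
    (AE x in M. AE q in M \<Otimes>\<^sub>M M. P x (fst q) (snd q))"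
proof -
  interpret pair_sigma_finite M M ..
  have "(AE y in M. AE z in M. P x y z) \<longleftrightarrow> (AE q in M \<Otimes>\<^sub>M M. P x (fst q) (snd q))" if "x \<in> space M" for x
  proof (rule AE_pair_iff)
    have "(\<lambda>q. (x, q)) \<in> M \<Otimes>\<^sub>M M \<rightarrow>\<^sub>M M \<Otimes>\<^sub>M (M \<Otimes>\<^sub>M M)" using that by simp
    from measurable_compose[OF this assms]
    show "{q \<in> space (M \<Otimes>\<^sub>M M). P x (fst q) (snd q)} \<in> sets (M \<Otimes>\<^sub>M M)"
      by (simp add: pred_def)
  qed
  then show ?thesis by (intro AE_cong) auto
qed

lemma (in prob_space) AE_triple_rotate:
  assumes m: "Measurable.pred (M \<Otimes>\<^sub>M (M \<Otimes>\<^sub>M M)) (\<lambda>z. P (fst z) (fst (snd z)) (snd (snd z)))"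
    and ae: "AE x in M. AE y in M. AE z in M. P x y z"
  shows "AE y in M. AE z in M. AE x in M. P x y z"
proof -
  interpret p: pair_prob_space M M ..
  interpret q: pair_sigma_finite M "M \<Otimes>\<^sub>M M" by unfold_locales
  have 1: "AE x in M. AE q in M \<Otimes>\<^sub>M M. P x (fst q) (snd q)"
    using AE_triple_iff[OF m] ae by simp
  have 2: "AE q in M \<Otimes>\<^sub>M M. AE x in M. P x (fst q) (snd q)"
    using q.AE_commute[of "\<lambda>x q. P x (fst q) (snd q)"] 1 m by (simp add: pred_def)
  show ?thesis using p.AE_pair[OF 2] by simp
qed

lemma (in prob_space) AE_triple_swap:
  assumes m: "Measurable.pred (M \<Otimes>\<^sub>M (M \<Otimes>\<^sub>M M)) (\<lambda>z. P (fst z) (fst (snd z)) (snd (snd z)))"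
    and ae: "AE x in M. AE y in M. AE z in M. P x y z"
  shows "AE x in M. AE z in M. AE y in M. P x y z"
proof (rule AE_mp[OF ae], rule AE_I2, rule impI)
  fix x assume x: "x \<in> space M" and "AE y in M. AE z in M. P x y z"
  moreover have "(\<lambda>q. (x, q)) \<in> M \<Otimes>\<^sub>M M \<rightarrow>\<^sub>M M \<Otimes>\<^sub>M (M \<Otimes>\<^sub>M M)" using x by simp
  from measurable_compose[OF this m]
  have "Measurable.pred (M \<Otimes>\<^sub>M M) (\<lambda>q. P x (fst q) (snd q))" by simp
  ultimately show "AE z in M. AE y in M. P x y z" using AE_swap[of "P x"] by blast
qed

text \<open>Transitivity nests the predecessor sets, so the key is monotone along \<open>S\<close>
  almost surely. It remains to exclude ties. Among three tied points in linear order, the middle one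
  would precede the largest but not the smallest, although nested predecessor sets of equal mass
  agree almost everywhere.\<close>

lemma (in prob_space) ordering_representation:
  assumes S[measurable]: "S \<in> sets (M \<Otimes>\<^sub>M M)"
    and tournament: "AE u in M. AE v in M. (u, v) \<in> S \<longleftrightarrow> (v, u) \<notin> S"
    and trans: "AE u in M. AE v in M. AE w in M. (u, v) \<in> S \<longrightarrow> (v, w) \<in> S \<longrightarrow> (u, w) \<in> S"
  defines "\<phi> \<equiv> \<lambda>u. measure M {w \<in> space M. (w, u) \<in> S}"
  shows "\<phi> \<in> borel_measurable M"
    and "AE u in M. AE v in M. \<phi> u \<noteq> \<phi> v"
    and "AE u in M. AE v in M. (u, v) \<in> S \<longleftrightarrow> \<phi> u < \<phi> v"
proof -
  have [measurable]: "Measurable.pred (M \<Otimes>\<^sub>M M) (\<lambda>z. (fst z, snd z) \<in> S)"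
    using S by (simp add: pred_def Collect_mem_eq)
  show \<phi>[measurable]: "\<phi> \<in> borel_measurable M"
    unfolding \<phi>_def by measurable
  have trans': "AE v in M. AE w in M. AE u in M. (u, v) \<in> S \<longrightarrow> (v, w) \<in> S \<longrightarrow> (u, w) \<in> S"
    by (rule AE_triple_rotate[OF _ trans]) measurable
  then have mono3: "AE u in M. AE v in M. AE w in M. (u, v) \<in> S \<longrightarrow> (w, u) \<in> S \<longrightarrow> (w, v) \<in> S"
    by eventually_elim (auto elim!: eventually_mono)
  have mono: "AE u in M. AE v in M. (u, v) \<in> S \<longrightarrow> \<phi> u \<le> \<phi> v"
    using mono3 AE_space
  proof eventually_elim
    case u: (elim u)
    from u(1) AE_space show ?case
    proof eventually_elim
      case (elim v)
      show ?case unfolding \<phi>_def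
      proof (intro impI finite_measure_mono_AE)
        assume "(u, v) \<in> S"
        with elim show "AE w in M. w \<in> {w \<in> space M. (w, u) \<in> S} \<longrightarrow> w \<in> {w \<in> space M. (w, v) \<in> S}"
          by (auto elim!: eventually_mono)
      qed (use elim(2) u(2) in measurable)
    qed
  qed
  \<comment> \<open>By \<open>mono3\<close> the predecessor set of \<open>u\<close> lies almost
    surely in that of \<open>v\<close>; equal masses then leave only a null set between
    them.\<close>
  have tied: "AE u in M. AE v in M. AE w in M. (u, v) \<in> S \<longrightarrow> \<phi> u = \<phi> v \<longrightarrow> (w, v) \<in> S \<longrightarrow> (w, u) \<in> S"
    using mono3 AE_space
  proof eventually_elim
    case u: (elim u)
    from u(1) AE_space show ?case
    proof eventually_elim
      case (elim v)
      show ?case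
      proof (cases "(u, v) \<in> S \<and> \<phi> u = \<phi> v")
        case True
        let ?U = "{w \<in> space M. (w, u) \<in> S}" and ?V = "{w \<in> space M. (w, v) \<in> S}"
        have sets: "?U \<in> sets M" "?V \<in> sets M"
          using elim(2) u(2) by measurable
        have le: "AE w in M. w \<in> ?U \<longrightarrow> w \<in> ?V"
          using elim True by (auto elim!: eventually_mono)
        have "measure M ?U = measure M (?U \<inter> ?V)"
          by (rule finite_measure_eq_AE) (use le sets in \<open>auto elim!: eventually_mono\<close>)
        moreover have "measure M ?U = measure M ?V"
          using True by (simp add: \<phi>_def)
        moreover have "measure M (?V - ?U) = measure M ?V - measure M (?V \<inter> ?U)"
          using sets by (rule finite_measure_Diff'[rotated])
        ultimately have "measure M (?V - ?U) = 0"
          by (simp add: Int_commute)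
        then have "AE w in M. w \<notin> ?V - ?U"
          using sets by (subst (asm) prob_eq_0) auto
        then show ?thesis
          by (auto elim!: eventually_mono)
      qed simp
    qed
  qed
  txt \<open>If three points were tied, \<open>G\<close> under all permutations would contradict the tournament property.\<close>
  define G where "G = (\<lambda>u v w. ((u, v) \<in> S \<longrightarrow> (v, w) \<in> S \<longrightarrow> (u, w) \<in> S) \<and>
    ((u, v) \<in> S \<longrightarrow> \<phi> u = \<phi> v \<longrightarrow> (w, v) \<in> S \<longrightarrow> (w, u) \<in> S))"
  have G[measurable]: "Measurable.pred (M \<Otimes>\<^sub>M (M \<Otimes>\<^sub>M M)) (\<lambda>z. G (f z) (g z) (h z))"
    if [measurable]: "f \<in> M \<Otimes>\<^sub>M (M \<Otimes>\<^sub>M M) \<rightarrow>\<^sub>M M" "g \<in> M \<Otimes>\<^sub>M (M \<Otimes>\<^sub>M M) \<rightarrow>\<^sub>M M"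
      "h \<in> M \<Otimes>\<^sub>M (M \<Otimes>\<^sub>M M) \<rightarrow>\<^sub>M M" for f g h
    unfolding G_def by measurable
  have G1: "AE u in M. AE v in M. AE w in M. G u v w"
    using trans tied
  proof eventually_elim
    case (elim u)
    then show ?case
    proof eventually_elim
      case (elim v)
      then show ?case unfolding G_def by eventually_elim blast
    qed
  qed
  have G2: "AE u in M. AE v in M. AE w in M. G w u v"
    by (rule AE_triple_rotate[OF _ G1]) measurable
  have G3: "AE u in M. AE v in M. AE w in M. G v w u"
    by (rule AE_triple_rotate[OF _ G2]) measurable
  have G4: "AE u in M. AE v in M. AE w in M. G u w v"
    by (rule AE_triple_swap[OF _ G1]) measurable
  have G5: "AE u in M. AE v in M. AE w in M. G v u w"
    by (rule AE_triple_swap[OF _ G2]) measurable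
  have G6: "AE u in M. AE v in M. AE w in M. G w v u"
    by (rule AE_triple_swap[OF _ G3]) measurable
  have "AE u in M. AE v in M. AE w in M. \<phi> v = \<phi> u \<longrightarrow> \<phi> w \<noteq> \<phi> u"
    using G1 G2 G3 G4 G5 G6 tournament
  proof eventually_elim
    case u: (elim u)
    from u(1-7) u(7) tournament show ?case
    proof eventually_elim
      case (elim v)
      from elim(1-6) elim(9) u(7) show ?case
        by eventually_elim (use elim(7) in \<open>unfold G_def, metis\<close>)
    qed
  qed
  then show ne: "AE u in M. AE v in M. \<phi> u \<noteq> \<phi> v"
  proof eventually_elim
    case (elim u)
    show ?case
    \<comment> \<open>If the points tied with \<open>u\<close> do not form a null set, then a
      typical \<open>v\<close> cannot be tied with \<open>u\<close>, as it would make almost every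
      \<open>w\<close> untied with \<open>u\<close>.\<close>
    proof (cases "AE w in M. \<phi> w \<noteq> \<phi> u")
      case True
      then show ?thesis by (auto elim!: eventually_mono)
    next
      case False
      from elim show ?thesis
        by eventually_elim (use False in auto)
    qed
  qed
  have mono': "AE u in M. AE v in M. (v, u) \<in> S \<longrightarrow> \<phi> v \<le> \<phi> u"
    by (rule AE_swap[OF _ mono]) measurable
  show "AE u in M. AE v in M. (u, v) \<in> S \<longleftrightarrow> \<phi> u < \<phi> v"
    using ne mono mono' tournament
  proof eventually_elim
    case (elim u)
    then show ?case by eventually_elim (auto simp: less_le)
  qed
qed

subsection \<open>Tuples with increasing keys\<close>

lemma (in prob_space) distr_PiM_pair:
  fixes i j :: 'i
  assumes "i \<in> J" "j \<in> J" "i \<noteq> j"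
  shows "distr (PiM J (\<lambda>_. M)) (M \<Otimes>\<^sub>M M) (\<lambda>x. (x i, x j)) = M \<Otimes>\<^sub>M M"
proof (rule pair_measure_eqI[symmetric])
  interpret P: product_prob_space "\<lambda>_. M" J by unfold_locales
  have [measurable]: "(\<lambda>x. x i) \<in> PiM J (\<lambda>_. M) \<rightarrow>\<^sub>M M" "(\<lambda>x. x j) \<in> PiM J (\<lambda>_. M) \<rightarrow>\<^sub>M M"
    using assms by measurable
  fix A B assume [measurable]: "A \<in> sets M" "B \<in> sets M"
  have "emeasure (distr (PiM J (\<lambda>_. M)) (M \<Otimes>\<^sub>M M) (\<lambda>x. (x i, x j))) (A \<times> B) =
    emeasure (PiM J (\<lambda>_. M)) {x \<in> space (PiM J (\<lambda>_. M)). \<forall>l\<in>{i, j}. x l \<in> (if l = i then A else B)}"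
    using assms(3) by (subst emeasure_distr) (auto intro!: arg_cong2[where f = emeasure] split: if_splits)
  also have "\<dots> = emeasure M A * emeasure M B"
    using assms by (subst P.emeasure_PiM_Collect) auto
  finally show "emeasure M A * emeasure M B =
    emeasure (distr (PiM J (\<lambda>_. M)) (M \<Otimes>\<^sub>M M) (\<lambda>x. (x i, x j))) (A \<times> B)" by simp
qed (simp_all add: sigma_finite_measure_axioms)

lemma (in prob_space) AE_PiM_pairs:
  assumes "AE z in M \<Otimes>\<^sub>M M. Q (fst z) (snd z)" "finite J"
  shows "AE x in PiM J (\<lambda>_. M). \<forall>i\<in>J. \<forall>j\<in>J. i \<noteq> j \<longrightarrow> Q (x i) (x j)"
proof -
  have "AE x in PiM J (\<lambda>_. M). i \<noteq> j \<longrightarrow> Q (x i) (x j)" if ij: "i \<in> J" "j \<in> J" for i j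
  proof (cases "i = j")
    case False
    have "AE x in PiM J (\<lambda>_. M). Q (fst (x i, x j)) (snd (x i, x j))"
    proof (rule AE_distrD[of _ _ "M \<Otimes>\<^sub>M M" "\<lambda>z. Q (fst z) (snd z)"])
      show "AE z in distr (PiM J (\<lambda>_. M)) (M \<Otimes>\<^sub>M M) (\<lambda>x. (x i, x j)). Q (fst z) (snd z)"
        using assms(1) by (simp only: distr_PiM_pair[OF ij False])
    qed (use ij in measurable)
    then show ?thesis by auto
  qed simp
  then show ?thesis
    using assms(2) by (simp add: AE_finite_all)
qed

lemma (in prob_space) distr_PiM_permute:
  assumes "\<sigma> permutes J"
  shows "distr (PiM J (\<lambda>_. M)) (PiM J (\<lambda>_. M)) (\<lambda>x. \<lambda>i\<in>J. x (\<sigma> i)) = PiM J (\<lambda>_. M)"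
  using distr_PiM_reindex[of J "\<lambda>_. M" \<sigma> J] permutes_inj_on[OF assms] permutes_in_image[OF assms]
  by (auto simp: prob_space_axioms)

text \<open>The index set is a parameter because the condition is needed for the whole tuple, for
  the head \<open>{1..k-1}\<close> and for the tail \<open>{k+1..n}\<close> separately.\<close>

definition increasing :: "('a \<Rightarrow> real) \<Rightarrow> nat set \<Rightarrow> (nat \<Rightarrow> 'a) \<Rightarrow> bool" where
  "increasing \<phi> J x \<longleftrightarrow> (\<forall>i\<in>J. \<forall>j\<in>J. i < j \<longrightarrow> \<phi> (x i) < \<phi> (x j))"

lemma increasing_restrict: "increasing \<phi> J (restrict x J) \<longleftrightarrow> increasing \<phi> J x"
  by (simp add: increasing_def)

lemma ex_increasing_permutation:
  fixes \<phi> :: "'a \<Rightarrow> real"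
  assumes "\<forall>i\<in>{a..b}. \<forall>j\<in>{a..b}. i \<noteq> j \<longrightarrow> \<phi> (x i) \<noteq> \<phi> (x j)"
  shows "\<exists>\<sigma>. \<sigma> permutes {a..b} \<and> increasing \<phi> {a..b} (\<lambda>i. x (\<sigma> i))"
proof -
  \<comment> \<open>\<open>r i\<close> is the position of \<open>x i\<close> after sorting, counted
    from \<open>a\<close>, so the sorting permutation is the inverse of \<open>r\<close>. Outside
    the interval \<open>r\<close> is the identity, as \<open>permutes\<close> demands.\<close>
  define r where "r i = (if i \<in> {a..b} then a + card {j\<in>{a..b}. \<phi> (x j) < \<phi> (x i)} else i)" for i
  have less: "r i < r j" if "i \<in> {a..b}" "j \<in> {a..b}" "\<phi> (x i) < \<phi> (x j)" for i j
  proof -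
    have "{l\<in>{a..b}. \<phi> (x l) < \<phi> (x i)} \<subset> {l\<in>{a..b}. \<phi> (x l) < \<phi> (x j)}"
      using that by force
    then show ?thesis
      using that by (simp add: r_def psubset_card_mono)
  qed
  have "r ` {a..b} \<subseteq> {a..b}"
  proof (rule image_subsetI)
    fix i assume i: "i \<in> {a..b}"
    have "{j\<in>{a..b}. \<phi> (x j) < \<phi> (x i)} \<subset> {a..b}"
      using i by blast
    then have "card {j\<in>{a..b}. \<phi> (x j) < \<phi> (x i)} < card {a..b}"
      by (rule psubset_card_mono[OF finite_atLeastAtMost])
    then show "r i \<in> {a..b}" using i by (auto simp: r_def)
  qed
  moreover have "inj_on r {a..b}"
  proof (rule inj_onI)
    fix i j assume "i \<in> {a..b}" "j \<in> {a..b}" "r i = r j"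
    then have "\<not> \<phi> (x i) < \<phi> (x j)" "\<not> \<phi> (x j) < \<phi> (x i)"
      using less[of i j] less[of j i] by auto
    then have "\<phi> (x i) = \<phi> (x j)" by simp
    then show "i = j" using assms \<open>i \<in> {a..b}\<close> \<open>j \<in> {a..b}\<close> by blast
  qed
  ultimately have "bij_betw r {a..b} {a..b}"
    using endo_inj_surj[of "{a..b}" r] by (simp add: bij_betw_def)
  then have r: "r permutes {a..b}"
    by (rule bij_imp_permutes) (simp only: r_def if_False)
  let ?\<sigma> = "inv r"
  have \<sigma>: "?\<sigma> permutes {a..b}" by (rule permutes_inv[OF r])
  have "\<phi> (x (?\<sigma> i)) < \<phi> (x (?\<sigma> j))" if ij: "i \<in> {a..b}" "j \<in> {a..b}" "i < j" for i j
  proof (rule ccontr)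
    assume *: "\<not> ?thesis"
    have in': "?\<sigma> i \<in> {a..b}" "?\<sigma> j \<in> {a..b}"
      using permutes_in_image[OF \<sigma>] ij by auto
    have r\<sigma>: "r (?\<sigma> i) = i" "r (?\<sigma> j) = j"
      by (simp_all add: permutes_inverses(1)[OF r])
    then have "\<phi> (x (?\<sigma> i)) \<noteq> \<phi> (x (?\<sigma> j))"
      using assms in' ij(3) by (metis less_irrefl)
    with * less[OF in'(2,1)] r\<sigma> ij(3) show False by auto
  qed
  with \<sigma> show ?thesis by (auto simp: increasing_def)
qed

locale tie_free = prob_space M for M :: "'a measure" +
  fixes \<phi> :: "'a \<Rightarrow> real"
  assumes measurable_key[measurable]: "\<phi> \<in> borel_measurable M"
    and tie_free: "AE x in M. AE y in M. \<phi> x \<noteq> \<phi> y"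
begin

lemma AE_pair_tie_free: "AE z in M \<Otimes>\<^sub>M M. \<phi> (fst z) \<noteq> \<phi> (snd z)"
proof -
  interpret pair_sigma_finite M M ..
  show ?thesis
    using tie_free by (subst AE_pair_iff[symmetric]) auto
qed

lemma AE_PiM_tie_free:
  "finite J \<Longrightarrow> AE x in PiM J (\<lambda>_. M). \<forall>i\<in>J. \<forall>j\<in>J. i \<noteq> j \<longrightarrow> \<phi> (x i) \<noteq> \<phi> (x j)"
  by (rule AE_PiM_pairs[OF AE_pair_tie_free])

lemma measurable_increasing[measurable]:
  assumes "countable J"
  shows "Measurable.pred (PiM J (\<lambda>_. M)) (increasing \<phi> J)"
proof -
  have "Measurable.pred (PiM J (\<lambda>_. M)) (\<lambda>x. \<forall>i\<in>J. \<forall>j\<in>J. i < j \<longrightarrow> \<phi> (x i) < \<phi> (x j))"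
    using assms by (intro pred_intros_countable_bounded) measurable
  then show ?thesis by (simp add: increasing_def[abs_def])
qed

text \<open>Almost surely some permutation sorts the tuple, and permuting coordinates preserves the
  product law. So if tuples with all entries in \<open>Z\<close> are almost never increasing, such
  tuples form a null set, and a positive power of the mass of \<open>Z\<close> is 0. This is the
  device that turns statements about increasing tuples into statements about almost every single
  point.\<close>

lemma null_if_never_increasing:
  assumes Z[measurable]: "Z \<in> sets M" and "a \<le> b"
    and never: "AE x in PiM {a..b} (\<lambda>_. M). (\<forall>i\<in>{a..b}. x i \<in> Z) \<longrightarrow> \<not> increasing \<phi> {a..b} x"
  shows "emeasure M Z = 0"
proof -
  let ?J = "{a..b}" and ?P = "PiM {a..b} (\<lambda>_. M)"
  interpret P: product_prob_space "\<lambda>_. M" ?J by unfold_locales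
  have perm: "AE x in ?P. (\<forall>i\<in>?J. x i \<in> Z) \<longrightarrow> \<not> increasing \<phi> ?J (\<lambda>i. x (\<sigma> i))"
    if \<sigma>: "\<sigma> permutes ?J" for \<sigma>
  proof -
    have meas: "(\<lambda>x. \<lambda>i\<in>?J. x (\<sigma> i)) \<in> ?P \<rightarrow>\<^sub>M ?P"
      by (intro measurable_restrict measurable_component_singleton) (simp only: permutes_in_image[OF \<sigma>])
    have "AE x in ?P. (\<forall>i\<in>?J. (\<lambda>i\<in>?J. x (\<sigma> i)) i \<in> Z) \<longrightarrow> \<not> increasing \<phi> ?J (\<lambda>i\<in>?J. x (\<sigma> i))"
      using never by (intro AE_distrD[OF meas]) (simp only: distr_PiM_permute[OF \<sigma>])
    then show ?thesis
      by eventually_elim (use permutes_in_image[OF \<sigma>] in \<open>simp add: increasing_def\<close>)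
  qed
  have "AE x in ?P. \<forall>\<sigma>\<in>{\<sigma>. \<sigma> permutes ?J}. (\<forall>i\<in>?J. x i \<in> Z) \<longrightarrow> \<not> increasing \<phi> ?J (\<lambda>i. x (\<sigma> i))"
    using perm by (subst AE_finite_all) (auto simp: finite_permutations)
  moreover have "AE x in ?P. \<forall>i\<in>?J. \<forall>j\<in>?J. i \<noteq> j \<longrightarrow> \<phi> (x i) \<noteq> \<phi> (x j)"
    by (rule AE_PiM_tie_free) simp
  ultimately have "AE x in ?P. \<not> (\<forall>i\<in>?J. x i \<in> Z)"
    by eventually_elim (use ex_increasing_permutation in blast)
  then have "emeasure ?P {x \<in> space ?P. \<forall>i\<in>?J. x i \<in> Z} = 0"
    by (subst (asm) AE_iff_measurable[OF _ refl]) auto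
  moreover have "emeasure ?P {x \<in> space ?P. \<forall>i\<in>?J. x i \<in> Z} = (\<Prod>i\<in>?J. emeasure M Z)"
    by (rule P.emeasure_PiM_Collect) auto
  ultimately show ?thesis by (simp add: prod_constant)
qed

end

subsection \<open>The law of the arrangement\<close>

abbreviation key_order :: "(real \<Rightarrow> real) \<Rightarrow> (real \<times> real) set" where
  "key_order \<phi> \<equiv> {(u, v). \<phi> u < \<phi> v}"

text \<open>Permutations are injective, so an arrangement compares entries at distinct indices only.
  Almost sure agreement of two relations on pairs of distinct coordinates is therefore enough to
  exchange them.\<close>

lemma arrangement_cong:
  assumes "\<And>i j. i \<in> {1..n} \<Longrightarrow> j \<in> {1..n} \<Longrightarrow> i \<noteq> j \<Longrightarrow> (x i, x j) \<in> R \<longleftrightarrow> (y i, y j) \<in> S"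
    and "\<And>i. i \<in> {1..n} \<Longrightarrow> x i = y i"
  shows "arrangement n R x = arrangement n S y"
proof -
  have "arranges n R x \<sigma> \<longleftrightarrow> arranges n S y \<sigma>" for \<sigma>
  proof (cases "\<sigma> permutes {1..n}")
    case True
    have "(x (\<sigma> i), x (\<sigma> j)) \<in> R \<longleftrightarrow> (y (\<sigma> i), y (\<sigma> j)) \<in> S" if "i \<in> {1..n}" "j \<in> {1..n}" "i < j" for i j
      using that assms(1)[of "\<sigma> i" "\<sigma> j"] permutes_in_image[OF True] permutes_inj[OF True]
      by (metis injD less_irrefl)
    then show ?thesis by (auto simp: arranges_def)
  qed (simp add: arranges_def)
  then have eq: "arranges n R x = arranges n S y" ..
  then have perm: "arranging_perm n R x = arranging_perm n S y"
    by (simp add: arranging_perm_def)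
  have "arranging_perm n S y permutes {1..n}"
  proof (cases "\<exists>!\<sigma>. arranges n S y \<sigma>")
    case True
    then have "arranges n S y (arranging_perm n S y)"
      unfolding arranging_perm_def by (simp add: theI')
    then show ?thesis by (simp add: arranges_def)
  qed (simp add: arranging_perm_def permutes_id)
  then show ?thesis
    using assms(2) permutes_in_image by (fastforce simp: arrangement_def perm)
qed

lemma arranges_key_order:
  "arranges n (key_order \<phi>) x \<sigma> \<longleftrightarrow> \<sigma> permutes {1..n} \<and> increasing \<phi> {1..n} (\<lambda>i. x (\<sigma> i))"
  by (auto simp: arranges_def increasing_def)

text \<open>At the first index where the two permutations differ, the entry chosen by either one
  occurs later under the other, so each key would be smaller than the other.\<close>

lemma increasing_permutation_unique:
  assumes \<sigma>: "\<sigma> permutes {1..n}" "increasing \<phi> {1..n} (\<lambda>i. x (\<sigma> i))"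
    and \<tau>: "\<tau> permutes {1..n}" "increasing \<phi> {1..n} (\<lambda>i. x (\<tau> i))"
  shows "\<sigma> = (\<tau> :: nat \<Rightarrow> nat)"
proof -
  have step: "\<phi> (x (\<alpha> i)) < \<phi> (x (\<beta> i))"
    if \<alpha>: "\<alpha> permutes {1..n}" "increasing \<phi> {1..n} (\<lambda>i. x (\<alpha> i))" and \<beta>: "\<beta> permutes {1..n}"
      and i: "i \<in> {1..n}" "\<alpha> i \<noteq> \<beta> i" "\<And>j. j < i \<Longrightarrow> \<alpha> j = \<beta> j" for \<alpha> \<beta> i
  proof -
    have "\<beta> i \<in> \<alpha> ` {1..n}"
      using permutes_in_image[OF \<beta>] i(1) permutes_image[OF \<alpha>(1)] by blast
    then obtain j where j: "j \<in> {1..n}" "\<beta> i = \<alpha> j" by auto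
    have "\<not> j < i"
      using i(3)[of j] j(2) permutes_inj[OF \<beta>] by (metis injD less_irrefl)
    with i(2) j(2) have "i < j" by (metis linorder_neqE_nat)
    then show ?thesis
      using \<alpha>(2) i(1) j by (simp add: increasing_def)
  qed
  have "\<sigma> i = \<tau> i" for i
  proof (induction i rule: less_induct)
    case (less i)
    show ?case
    proof (cases "i \<in> {1..n}")
      case True
      show ?thesis
        using step[OF \<sigma> \<tau>(1) True _ less] step[OF \<tau> \<sigma>(1) True _ less[symmetric]] by fastforce
    next
      case False
      then show ?thesis
        using permutes_not_in[OF \<sigma>(1)] permutes_not_in[OF \<tau>(1)] by simp
    qed
  qed
  then show ?thesis by auto
qed

lemma arranging_perm_key_order:
  assumes "\<sigma> permutes {1..n}" "increasing \<phi> {1..n} (\<lambda>i. x (\<sigma> i))"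
  shows "arranging_perm n (key_order \<phi>) x = \<sigma>"
proof -
  have *: "arranges n (key_order \<phi>) x \<tau> \<longleftrightarrow> \<tau> = \<sigma>" for \<tau>
    unfolding arranges_key_order using increasing_permutation_unique[OF _ _ assms] assms by blast
  have "\<exists>!\<tau>. arranges n (key_order \<phi>) x \<tau>"
    by (simp only: *) blast
  moreover have "(THE \<tau>. arranges n (key_order \<phi>) x \<tau>) = \<sigma>"
    by (rule the_equality) (simp_all only: *)
  ultimately show ?thesis by (simp only: arranging_perm_def if_True)
qed

locale real_tie_free = tie_free M \<phi> for M :: "real measure" and \<phi> :: "real \<Rightarrow> real" +
  assumes sets_M[measurable_cong]: "sets M = sets borel"
begin

abbreviation law :: "nat set \<Rightarrow> (nat \<Rightarrow> real) measure" where
  "law J \<equiv> PiM J (\<lambda>_. M)"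

lemma sets_vec_space: "sets (vec_space n) = sets (law {1..n})"
  unfolding vec_space_def by (intro sets_PiM_cong) (auto simp: sets_M)

lemma measurable_permute:
  "\<sigma> permutes J \<Longrightarrow> (\<lambda>x. \<lambda>i\<in>J. x (\<sigma> i)) \<in> law J \<rightarrow>\<^sub>M law J"
  by (intro measurable_restrict measurable_component_singleton) (simp only: permutes_in_image)

lemma measurable_increasing_permute:
  assumes "\<sigma> permutes J" "countable J"
  shows "Measurable.pred (law J) (\<lambda>x. increasing \<phi> J (\<lambda>i. x (\<sigma> i)))"
proof -
  have "Measurable.pred (law J) (\<lambda>x. increasing \<phi> J (\<lambda>i\<in>J. x (\<sigma> i)))"
    by (rule measurable_compose[OF measurable_permute measurable_increasing]) fact+
  then show ?thesis by (simp only: increasing_restrict)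
qed

lemma measurable_arrangement: "arrangement n (key_order \<phi>) \<in> law {1..n} \<rightarrow>\<^sub>M vec_space n"
proof -
  let ?J = "{1..n}" and ?p = "arranging_perm n (key_order \<phi>)"
  have perm: "?p x \<in> {\<sigma>. \<sigma> permutes ?J}" for x
  proof (cases "\<exists>\<sigma>. \<sigma> permutes ?J \<and> increasing \<phi> ?J (\<lambda>i. x (\<sigma> i))")
    case True
    then show ?thesis using arranging_perm_key_order[of _ n \<phi> x] by auto
  next
    case False
    then show ?thesis
      by (auto simp: arranging_perm_def arranges_key_order permutes_id)
  qed
  have p: "?p \<in> law ?J \<rightarrow>\<^sub>M count_space {\<sigma>. \<sigma> permutes ?J}"
  proof (subst measurable_count_space_eq2)
    show "?p \<in> space (law ?J) \<rightarrow> {\<sigma>. \<sigma> permutes ?J} \<and>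
      (\<forall>\<sigma>\<in>{\<sigma>. \<sigma> permutes ?J}. ?p -` {\<sigma>} \<inter> space (law ?J) \<in> sets (law ?J))"
    proof (intro conjI ballI)
      fix \<sigma> assume "\<sigma> \<in> {\<sigma>. \<sigma> permutes ?J}"
      then have \<sigma>: "\<sigma> permutes ?J" by simp
      \<comment> \<open>If no permutation makes the keys increasing, \<open>arranging_perm\<close>
        takes its default \<open>id\<close>; the preimage of \<open>id\<close> contains this event
        as well.\<close>
      have "?p x = \<sigma> \<longleftrightarrow> increasing \<phi> ?J (\<lambda>i. x (\<sigma> i)) \<or>
        \<sigma> = id \<and> (\<forall>\<tau>\<in>{\<tau>. \<tau> permutes ?J}. \<not> increasing \<phi> ?J (\<lambda>i. x (\<tau> i)))" for x
      proof (cases "\<exists>\<sigma>. \<sigma> permutes ?J \<and> increasing \<phi> ?J (\<lambda>i. x (\<sigma> i))")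
        case True
        then show ?thesis using arranging_perm_key_order[of _ n \<phi> x] \<sigma> by auto
      next
        case False
        then have "?p x = id"
          by (auto simp: arranging_perm_def arranges_key_order)
        then show ?thesis using False \<sigma> by auto
      qed
      then have "?p -` {\<sigma>} \<inter> space (law ?J) =
        {x \<in> space (law ?J). increasing \<phi> ?J (\<lambda>i. x (\<sigma> i)) \<or>
          \<sigma> = id \<and> (\<forall>\<tau>\<in>{\<tau>. \<tau> permutes ?J}. \<not> increasing \<phi> ?J (\<lambda>i. x (\<tau> i)))}"
        by auto
      also have "\<dots> \<in> sets (law ?J)"
      proof -
        have incr: "Measurable.pred (law ?J) (\<lambda>x. increasing \<phi> ?J (\<lambda>i. x (\<tau> i)))"
          if "\<tau> \<in> {\<tau>. \<tau> permutes ?J}" for \<tau>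
          using that by (intro measurable_increasing_permute) auto
        have [measurable]: "Measurable.pred (law ?J) (\<lambda>x. \<forall>\<tau>\<in>{\<tau>. \<tau> permutes ?J}. \<not> increasing \<phi> ?J (\<lambda>i. x (\<tau> i)))"
          by (intro pred_intros_finite pred_intros_logic finite_permutations finite_atLeastAtMost incr)
        have [measurable]: "Measurable.pred (law ?J) (\<lambda>x. increasing \<phi> ?J (\<lambda>i. x (\<sigma> i)))"
          using \<sigma> by (intro incr) simp
        show ?thesis by measurable
      qed
      finally show "?p -` {\<sigma>} \<inter> space (law ?J) \<in> sets (law ?J)" .
    qed (use perm in auto)
  qed (simp add: finite_permutations)
  show ?thesis
    unfolding vec_space_def arrangement_def
  proof (rule measurable_restrict)
    fix i assume i: "i \<in> ?J"
    show "(\<lambda>x. x (?p x i)) \<in> borel_measurable (law ?J)"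
    proof (rule measurable_compose_countable'[OF _ p])
      fix \<sigma> assume "\<sigma> \<in> {\<sigma>. \<sigma> permutes ?J}"
      then have in_J: "\<sigma> i \<in> ?J" using i permutes_in_image[of \<sigma> ?J i] by blast
      show "(\<lambda>x. x (\<sigma> i)) \<in> borel_measurable (law ?J)"
        using measurable_component_singleton[OF in_J, of "\<lambda>_. M"] by (simp add: measurable_cong_sets[OF refl sets_M])
    qed (simp add: finite_permutations countable_finite)
  qed
qed

text \<open>Up to ties, the preimage of \<open>B\<close> is the disjoint union of the events
  \<open>F \<sigma>\<close> that \<open>\<sigma>\<close> sorts the tuple into an element of
  \<open>B\<close>. Permuting coordinates shows that all \<open>n!\<close> of them have the mass of
  \<open>F id\<close>.\<close>

lemma emeasure_arrangement:
  assumes B: "B \<in> sets (vec_space n)"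
  shows "emeasure (distr (law {1..n}) (vec_space n) (arrangement n (key_order \<phi>))) B =
    of_nat (fact n) * emeasure (law {1..n}) {x \<in> space (law {1..n}). increasing \<phi> {1..n} x \<and> x \<in> B}"
proof -
  let ?J = "{1..n}" and ?a = "arrangement n (key_order \<phi>)"
  let ?P = "law ?J" and ?S = "{\<sigma>. \<sigma> permutes ?J}"
  have B'[measurable]: "B \<in> sets ?P" using B by (simp only: sets_vec_space)
  define F where "F \<sigma> = {x \<in> space ?P. increasing \<phi> ?J (\<lambda>i. x (\<sigma> i)) \<and> (\<lambda>i\<in>?J. x (\<sigma> i)) \<in> B}" for \<sigma>
  have F_sets: "F \<sigma> \<in> sets ?P" if "\<sigma> \<in> ?S" for \<sigma>
  proof -
    have [measurable]: "Measurable.pred ?P (\<lambda>x. increasing \<phi> ?J (\<lambda>i. x (\<sigma> i)))"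
      "(\<lambda>x. \<lambda>i\<in>?J. x (\<sigma> i)) \<in> ?P \<rightarrow>\<^sub>M ?P"
      using that by (auto intro: measurable_increasing_permute measurable_permute)
    show ?thesis unfolding F_def by measurable
  qed
  have F: "emeasure ?P (F \<sigma>) = emeasure ?P (F id)" if \<sigma>: "\<sigma> \<in> ?S" for \<sigma>
  proof -
    have "emeasure ?P (F id) = emeasure (distr ?P ?P (\<lambda>x. \<lambda>i\<in>?J. x (\<sigma> i))) (F id)"
      using \<sigma> by (simp add: distr_PiM_permute)
    also have "\<dots> = emeasure ?P ((\<lambda>x. \<lambda>i\<in>?J. x (\<sigma> i)) -` F id \<inter> space ?P)"
      using \<sigma> F_sets[of id] by (intro emeasure_distr measurable_permute) (auto simp: permutes_id)
    also have "(\<lambda>x. \<lambda>i\<in>?J. x (\<sigma> i)) -` F id \<inter> space ?P = F \<sigma>"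
      using measurable_space[OF measurable_permute, of \<sigma> ?J] \<sigma>
      by (auto simp: F_def increasing_def)
    finally show ?thesis by (rule sym)
  qed
  have "emeasure (distr ?P (vec_space n) ?a) B = emeasure ?P (?a -` B \<inter> space ?P)"
    by (rule emeasure_distr[OF measurable_arrangement B])
  also have "\<dots> = emeasure ?P (\<Union>\<sigma>\<in>?S. F \<sigma>)"
  proof (rule emeasure_eq_AE)
    have "AE x in ?P. \<forall>i\<in>?J. \<forall>j\<in>?J. i \<noteq> j \<longrightarrow> \<phi> (x i) \<noteq> \<phi> (x j)"
      by (rule AE_PiM_tie_free) simp
    then show "AE x in ?P. x \<in> ?a -` B \<inter> space ?P \<longleftrightarrow> x \<in> (\<Union>\<sigma>\<in>?S. F \<sigma>)"
    proof eventually_elim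
      case (elim x)
      from ex_increasing_permutation[of 1 n \<phi> x, OF elim]
      obtain \<sigma> where \<sigma>: "\<sigma> permutes ?J" "increasing \<phi> ?J (\<lambda>i. x (\<sigma> i))" by blast
      have a: "?a x = (\<lambda>i\<in>?J. x (\<sigma> i))"
        by (simp only: arrangement_def arranging_perm_key_order[OF \<sigma>])
      have "x \<in> (\<Union>\<sigma>\<in>?S. F \<sigma>) \<longleftrightarrow> x \<in> F \<sigma>"
      proof
        assume "x \<in> (\<Union>\<sigma>\<in>?S. F \<sigma>)"
        then obtain \<tau> where "\<tau> permutes ?J" "x \<in> F \<tau>" by blast
        moreover from this have "\<sigma> = \<tau>"
          by (intro increasing_permutation_unique[where x = x, OF \<sigma>]) (simp_all only: F_def mem_Collect_eq)
        ultimately show "x \<in> F \<sigma>" by simp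
      qed (use \<sigma>(1) in blast)
      then show ?case
        using \<sigma>(2) by (simp only: F_def a vimage_eq Int_iff mem_Collect_eq) blast
    qed
    show "?a -` B \<inter> space ?P \<in> sets ?P"
      by (rule measurable_sets[OF measurable_arrangement B])
  qed (use F_sets in \<open>auto intro!: sets.finite_UN simp: finite_permutations\<close>)
  also have "\<dots> = (\<Sum>\<sigma>\<in>?S. emeasure ?P (F \<sigma>))"
  proof (rule sum_emeasure[symmetric])
    show "disjoint_family_on F ?S"
      unfolding disjoint_family_on_def
    proof (intro ballI impI)
      fix \<sigma> \<tau> assume "\<sigma> \<in> ?S" "\<tau> \<in> ?S" "\<sigma> \<noteq> \<tau>"
      then show "F \<sigma> \<inter> F \<tau> = {}"
        using increasing_permutation_unique[of \<sigma> n \<phi> _ \<tau>] unfolding F_def by blast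
    qed
  qed (use F_sets in \<open>auto simp: finite_permutations\<close>)
  also have "\<dots> = (\<Sum>\<sigma>\<in>?S. emeasure ?P (F id))"
    by (intro sum.cong refl F)
  also have "\<dots> = of_nat (fact n) * emeasure ?P (F id)"
    by (simp add: card_permutations[OF refl])
  also have "F id = {x \<in> space ?P. increasing \<phi> ?J x \<and> x \<in> B}"
    by (auto simp: F_def space_PiM PiE_restrict)
  finally show ?thesis .
qed

end

subsection \<open>The conditional law of one coordinate\<close>

text \<open>This is the Markov structure of increasing tuples: the entry at \<open>k\<close>
  interacts with the head only through its last key, and with the tail only through the condition
  that all tail keys exceed its own.\<close>

lemma increasing_split:
  assumes "2 \<le> k" "k \<le> n"
  shows "increasing \<phi> {1..n} x \<longleftrightarrow>
    increasing \<phi> {1..k-1} x \<and> \<phi> (x (k - 1)) < \<phi> (x k) \<and>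
    increasing \<phi> {k+1..n} x \<and> (\<forall>j\<in>{k+1..n}. \<phi> (x k) < \<phi> (x j))" (is "?L \<longleftrightarrow> ?R")
proof
  assume L: ?L
  have "k - 1 \<in> {1..n}" "k \<in> {1..n}" "k - 1 < k" using assms by auto
  with L have "\<phi> (x (k - 1)) < \<phi> (x k)" unfolding increasing_def by blast
  with L show ?R using assms by (auto simp: increasing_def)
next
  assume R: ?R
  have less_k: "\<phi> (x i) < \<phi> (x k)" if "1 \<le> i" "i < k" for i
  proof (cases "i = k - 1")
    case False
    then have "\<phi> (x i) < \<phi> (x (k - 1))"
      using R that assms by (simp add: increasing_def)
    also have "\<dots> < \<phi> (x k)" using R by simp
    finally show ?thesis .
  qed (use R in simp)
  show ?L
    unfolding increasing_def
  proof (intro ballI impI)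
    fix i j assume ij: "i \<in> {1..n}" "j \<in> {1..n}" "i < j"
    consider "j < k" | "j = k" | "i = k" | "k < i" | "i < k" "k < j" by linarith
    then show "\<phi> (x i) < \<phi> (x j)"
    proof cases
      case 5
      with less_k[of i] R ij show ?thesis by (force intro: less_trans)
    qed (use R ij less_k in \<open>auto simp: increasing_def\<close>)
  qed
qed

context real_tie_free
begin

text \<open>Probability that the remaining entries complete an entry of key \<open>t\<close> at
  position \<open>k\<close> to an increasing tuple. For \<open>k \<le> n\<close> it equals
  \<open>1 / (n - k)!\<close> times the power \<open>n - k\<close> of the mass of keys above
  \<open>t\<close>; in particular it is constantly 1 for \<open>k = n\<close>.\<close>

definition tail_weight :: "nat \<Rightarrow> nat \<Rightarrow> real \<Rightarrow> ennreal" where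
  "tail_weight k n t = emeasure (law {k+1..n})
     {z \<in> space (law {k+1..n}). increasing \<phi> {k+1..n} z \<and> (\<forall>j\<in>{k+1..n}. t < \<phi> (z j))}"

lemma sigma_finite_law: "finite J \<Longrightarrow> sigma_finite_measure (law J)"
  by (intro prob_space_imp_sigma_finite prob_space_PiM prob_space_axioms)

lemma measurable_tail_weight[measurable]: "tail_weight k n \<in> borel_measurable borel"
proof -
  let ?J = "{k+1..n}"
  interpret L: sigma_finite_measure "law ?J" by (rule sigma_finite_law) simp
  have [measurable]: "Measurable.pred (borel \<Otimes>\<^sub>M law ?J) (\<lambda>z. \<forall>j\<in>?J. fst z < \<phi> (snd z j))"
    by (intro pred_intros_finite) measurable
  have [measurable]: "Measurable.pred (borel \<Otimes>\<^sub>M law ?J) (\<lambda>z. increasing \<phi> ?J (snd z))"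
    by (rule measurable_compose[OF measurable_snd measurable_increasing]) auto
  have "(\<lambda>t. emeasure (law ?J) {z \<in> space (law ?J). increasing \<phi> ?J z \<and> (\<forall>j\<in>?J. t < \<phi> (z j))})
    \<in> borel_measurable borel"
    by (rule L.measurable_emeasure) (auto simp: space_pair_measure pred_def[symmetric])
  then show ?thesis by (simp add: tail_weight_def[abs_def])
qed

lemma tail_weight_le_1: "tail_weight k n t \<le> 1"
proof -
  interpret L: prob_space "law {k+1..n}" by (intro prob_space_PiM prob_space_axioms)
  show ?thesis unfolding tail_weight_def by (rule L.emeasure_le_1)
qed

sublocale factors: product_sigma_finite "\<lambda>_ :: nat. M"
  by unfold_locales

text \<open>Fubini in the order head, entry at \<open>k\<close>, tail. By
  \<open>increasing_split\<close> the innermost integral over the tail is \<open>tail_weight\<close>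
  at the key of the entry at \<open>k\<close>.\<close>

lemma emeasure_increasing_split:
  assumes k: "2 \<le> k" "k \<le> n"
    and Q[measurable]: "Measurable.pred (law {1..k-1} \<Otimes>\<^sub>M M) (\<lambda>z. Q (fst z) (snd z))"
  shows "emeasure (law {1..n}) {x \<in> space (law {1..n}). increasing \<phi> {1..n} x \<and> Q (restrict x {1..k-1}) (x k)} =
    (\<integral>\<^sup>+y. indicator {y. increasing \<phi> {1..k-1} y} y *
      (\<integral>\<^sup>+x. indicator {x. \<phi> (y (k - 1)) < \<phi> x \<and> Q y x} x * tail_weight k n (\<phi> x) \<partial>M) \<partial>law {1..k-1})"
proof -
  let ?I = "{1..k-1}" and ?K = "{k+1..n}" and ?J = "{1..n}"
  define E where "E = {x \<in> space (law ?J). increasing \<phi> ?J x \<and> Q (restrict x ?I) (x k)}"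
  have J: "?J = ?I \<union> insert k ?K" using k by auto
  have [measurable]: "(\<lambda>x. restrict x ?I) \<in> law ?J \<rightarrow>\<^sub>M law ?I"
    by (rule measurable_restrict_subset) (use k in auto)
  have [measurable]: "(\<lambda>x. x k) \<in> law ?J \<rightarrow>\<^sub>M M"
    by (rule measurable_component_singleton) (use k in auto)
  have pair: "(\<lambda>x. (restrict x ?I, x k)) \<in> law ?J \<rightarrow>\<^sub>M law ?I \<Otimes>\<^sub>M M"
    by measurable
  have [measurable]: "Measurable.pred (law ?J) (\<lambda>x. Q (restrict x ?I) (x k))"
    using measurable_compose[OF pair Q] by simp
  have E[measurable]: "E \<in> sets (law ?J)" unfolding E_def by measurable
  have E': "E \<in> sets (law (?I \<union> insert k ?K))" using E by (simp only: J)
  have "emeasure (law ?J) E = (\<integral>\<^sup>+x. indicator E x \<partial>law (?I \<union> insert k ?K))"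
    using E' by (simp only: J nn_integral_indicator)
  also have "\<dots> = (\<integral>\<^sup>+y. \<integral>\<^sup>+z. indicator E (merge ?I (insert k ?K) (y, z)) \<partial>law (insert k ?K) \<partial>law ?I)"
    by (rule factors.product_nn_integral_fold) (use E' in auto)
  also have "\<dots> = (\<integral>\<^sup>+y. indicator {y. increasing \<phi> ?I y} y *
      (\<integral>\<^sup>+x. indicator {x. \<phi> (y (k - 1)) < \<phi> x \<and> Q y x} x * tail_weight k n (\<phi> x) \<partial>M) \<partial>law ?I)"
  proof (rule nn_integral_cong)
    fix y assume y: "y \<in> space (law ?I)"
    have sec: "(\<lambda>z. merge ?I (insert k ?K) (y, z)) \<in> law (insert k ?K) \<rightarrow>\<^sub>M law (?I \<union> insert k ?K)"
      using y by measurable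
    have "(\<integral>\<^sup>+z. indicator E (merge ?I (insert k ?K) (y, z)) \<partial>law (insert k ?K)) =
      (\<integral>\<^sup>+x. \<integral>\<^sup>+z. indicator E (merge ?I (insert k ?K) (y, z(k := x))) \<partial>law ?K \<partial>M)"
      by (rule factors.product_nn_integral_insert_rev)
        (use measurable_compose[OF sec borel_measurable_indicator[OF E']] in auto)
    also have "\<dots> = (\<integral>\<^sup>+x. indicator {y. increasing \<phi> ?I y} y *
       (indicator {x. \<phi> (y (k - 1)) < \<phi> x \<and> Q y x} x * tail_weight k n (\<phi> x)) \<partial>M)"
    proof (rule nn_integral_cong)
      fix x assume x: "x \<in> space M"
      let ?T = "{z \<in> space (law ?K). increasing \<phi> ?K z \<and> (\<forall>j\<in>?K. \<phi> x < \<phi> (z j))}"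
      have T[measurable]: "?T \<in> sets (law ?K)"
      proof -
        have [measurable]: "Measurable.pred (law ?K) (\<lambda>z. \<forall>j\<in>?K. \<phi> x < \<phi> (z j))"
          by (intro pred_intros_finite) measurable
        show ?thesis by measurable
      qed
      \<comment> \<open>On a merged tuple the event factors into a condition on the head, one on the
        pair of head and entry at \<open>k\<close>, and one on the tail that sees only
        \<open>\<phi> x\<close>.\<close>
      have "indicator E (merge ?I (insert k ?K) (y, z(k := x))) =
        indicator {y. increasing \<phi> ?I y} y * indicator {x. \<phi> (y (k - 1)) < \<phi> x \<and> Q y x} x *
        (indicator ?T z :: ennreal)" if z: "z \<in> space (law ?K)" for z
      proof -
        let ?m = "merge ?I (insert k ?K) (y, z(k := x))"
        have m_I: "i \<in> ?I \<Longrightarrow> ?m i = y i" for i by (simp add: merge_def)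
        have m_k: "?m k = x" using k by (auto simp: merge_def)
        have m_K: "j \<in> ?K \<Longrightarrow> ?m j = z j" for j by (auto simp: merge_def)
        have "z(k := x) \<in> space (law (insert k ?K))"
          using z x unfolding space_PiM by (intro PiE_fun_upd)
        then have "?m \<in> space (law ?J)"
          unfolding J by (intro measurable_space[OF sec])
        moreover have "restrict ?m ?I = y"
          using y by (auto simp: space_PiM PiE_def extensional_def restrict_def merge_def fun_eq_iff)
        moreover have "increasing \<phi> ?J ?m \<longleftrightarrow> increasing \<phi> ?I y \<and> \<phi> (y (k - 1)) < \<phi> x \<and>
          increasing \<phi> ?K z \<and> (\<forall>j\<in>?K. \<phi> x < \<phi> (z j))"
        proof -
          have "increasing \<phi> ?I ?m = increasing \<phi> ?I y"
            unfolding increasing_def using m_I by simp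
          moreover have "increasing \<phi> ?K ?m = increasing \<phi> ?K z"
            unfolding increasing_def using m_K by simp
          moreover have "?m (k - 1) = y (k - 1)" using k by (intro m_I) auto
          ultimately show ?thesis
            unfolding increasing_split[OF k] m_k using m_K by simp
        qed
        ultimately have "?m \<in> E \<longleftrightarrow> increasing \<phi> ?I y \<and> (\<phi> (y (k - 1)) < \<phi> x \<and> Q y x) \<and> z \<in> ?T"
          unfolding E_def using z m_k by auto
        then show ?thesis by (auto simp: indicator_def)
      qed
      then have "(\<integral>\<^sup>+z. indicator E (merge ?I (insert k ?K) (y, z(k := x))) \<partial>law ?K) =
        (\<integral>\<^sup>+z. indicator {y. increasing \<phi> ?I y} y * indicator {x. \<phi> (y (k - 1)) < \<phi> x \<and> Q y x} x *
          (indicator ?T z :: ennreal) \<partial>law ?K)"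
        by (intro nn_integral_cong)
      also have "\<dots> = indicator {y. increasing \<phi> ?I y} y * indicator {x. \<phi> (y (k - 1)) < \<phi> x \<and> Q y x} x *
          emeasure (law ?K) ?T"
        using T by (simp add: nn_integral_cmult)
      finally show "(\<integral>\<^sup>+z. indicator E (merge ?I (insert k ?K) (y, z(k := x))) \<partial>law ?K) =
        indicator {y. increasing \<phi> ?I y} y *
         (indicator {x. \<phi> (y (k - 1)) < \<phi> x \<and> Q y x} x * tail_weight k n (\<phi> x))"
        by (simp add: tail_weight_def mult.assoc)
    qed
    also have "\<dots> = indicator {y. increasing \<phi> ?I y} y *
       (\<integral>\<^sup>+x. indicator {x. \<phi> (y (k - 1)) < \<phi> x \<and> Q y x} x * tail_weight k n (\<phi> x) \<partial>M)"
    proof (rule nn_integral_cmult)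
      have "(\<lambda>x. (y, x)) \<in> M \<rightarrow>\<^sub>M law ?I \<Otimes>\<^sub>M M" using y by measurable
      from measurable_compose[OF this Q] have [measurable]: "Measurable.pred M (Q y)" by simp
      show "(\<lambda>x. indicator {x. \<phi> (y (k - 1)) < \<phi> x \<and> Q y x} x * tail_weight k n (\<phi> x)) \<in> borel_measurable M"
        by (simp add: indicator_def[abs_def])
    qed
    finally show "(\<integral>\<^sup>+z. indicator E (merge ?I (insert k ?K) (y, z)) \<partial>law (insert k ?K)) = \<dots>" .
  qed
  finally show ?thesis by (simp only: E_def)
qed

text \<open>The hypothesis \<open>eq\<close> says that an event about head and \<open>k\<close>-th
  entry has conditional probability \<open>p\<close> whatever the head. By
  \<open>emeasure_increasing_split\<close> both sides are integrals over the set \<open>B\<close> of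
  heads, and the densities of equal measures agree almost everywhere.\<close>

lemma AE_conditional_weight:
  assumes k: "2 \<le> k" "k \<le> n"
    and Q[measurable]: "Measurable.pred (law {1..k-1} \<Otimes>\<^sub>M M) (\<lambda>z. Q (fst z) (snd z))"
    and eq: "\<And>B. B \<in> sets (law {1..k-1}) \<Longrightarrow>
      emeasure (law {1..n}) {x \<in> space (law {1..n}). increasing \<phi> {1..n} x \<and>
        restrict x {1..k-1} \<in> B \<and> Q (restrict x {1..k-1}) (x k)} =
      p * emeasure (law {1..n}) {x \<in> space (law {1..n}). increasing \<phi> {1..n} x \<and> restrict x {1..k-1} \<in> B}"
  shows "AE y in law {1..k-1}. increasing \<phi> {1..k-1} y \<longrightarrow>
    (\<integral>\<^sup>+x. indicator {x. \<phi> (y (k - 1)) < \<phi> x \<and> Q y x} x * tail_weight k n (\<phi> x) \<partial>M) =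
    p * (\<integral>\<^sup>+x. indicator {x. \<phi> (y (k - 1)) < \<phi> x} x * tail_weight k n (\<phi> x) \<partial>M)"
proof -
  let ?I = "{1..k-1}"
  interpret L: sigma_finite_measure "law ?I" by (rule sigma_finite_law) simp
  define F where "F R y = indicator {y. increasing \<phi> ?I y} y *
      (\<integral>\<^sup>+x. indicator {x. \<phi> (y (k - 1)) < \<phi> x \<and> R y x} x * tail_weight k n (\<phi> x) \<partial>M)"
    for R :: "(nat \<Rightarrow> real) \<Rightarrow> real \<Rightarrow> bool" and y
  have [measurable]: "(\<lambda>y. y (k - 1)) \<in> law ?I \<rightarrow>\<^sub>M M"
    by (rule measurable_component_singleton) (use k in auto)
  have F: "F R \<in> borel_measurable (law ?I)"
    if [measurable]: "Measurable.pred (law ?I \<Otimes>\<^sub>M M) (\<lambda>z. R (fst z) (snd z))" for R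
  proof -
    have "(\<lambda>y. (if increasing \<phi> ?I y then 1 else 0) *
      (\<integral>\<^sup>+x. (if \<phi> (y (k - 1)) < \<phi> x \<and> R y x then 1 else 0) * tail_weight k n (\<phi> x) \<partial>M)) \<in> borel_measurable (law ?I)"
      by measurable
    then show ?thesis by (simp add: F_def[abs_def] indicator_def[abs_def] of_bool_def)
  qed
  have set_integral: "(\<integral>\<^sup>+y. F R y * indicator B y \<partial>law ?I) =
      emeasure (law {1..n}) {x \<in> space (law {1..n}). increasing \<phi> {1..n} x \<and>
        restrict x ?I \<in> B \<and> R (restrict x ?I) (x k)}"
    if R[measurable]: "Measurable.pred (law ?I \<Otimes>\<^sub>M M) (\<lambda>z. R (fst z) (snd z))"
      and B[measurable]: "B \<in> sets (law ?I)" for R B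
  proof -
    \<comment> \<open>Membership in \<open>B\<close> is absorbed into the predicate, so that the
      splitting formula also evaluates integrals over \<open>B\<close>.\<close>
    have "F R y * indicator B y = F (\<lambda>y x. y \<in> B \<and> R y x) y" for y
      by (cases "y \<in> B") (simp_all add: F_def)
    then have "(\<integral>\<^sup>+y. F R y * indicator B y \<partial>law ?I) = (\<integral>\<^sup>+y. F (\<lambda>y x. y \<in> B \<and> R y x) y \<partial>law ?I)"
      by simp
    also have "\<dots> = emeasure (law {1..n}) {x \<in> space (law {1..n}). increasing \<phi> {1..n} x \<and>
        restrict x ?I \<in> B \<and> R (restrict x ?I) (x k)}"
      unfolding F_def by (rule emeasure_increasing_split[symmetric, OF k]) measurable
    finally show ?thesis .
  qed
  have "AE y in law ?I. F Q y = p * F (\<lambda>_ _. True) y"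
  proof (rule L.density_unique2)
    have T: "F (\<lambda>_ _. True) \<in> borel_measurable (law ?I)" by (rule F) simp
    then show "(\<lambda>y. p * F (\<lambda>_ _. True) y) \<in> borel_measurable (law ?I)" by measurable
    fix B assume B: "B \<in> sets (law ?I)"
    have "(\<integral>\<^sup>+y. F Q y * indicator B y \<partial>law ?I) =
      p * emeasure (law {1..n}) {x \<in> space (law {1..n}). increasing \<phi> {1..n} x \<and> restrict x ?I \<in> B}"
      using set_integral[OF Q B] eq[OF B] by (rule trans)
    also have "\<dots> = p * (\<integral>\<^sup>+y. F (\<lambda>_ _. True) y * indicator B y \<partial>law ?I)"
      using set_integral[of "\<lambda>_ _. True", OF _ B] by simp
    also have "\<dots> = (\<integral>\<^sup>+y. p * F (\<lambda>_ _. True) y * indicator B y \<partial>law ?I)"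
      using T B by (simp add: mult.assoc nn_integral_cmult)
    finally show "(\<integral>\<^sup>+y\<in>B. F Q y \<partial>law ?I) = (\<integral>\<^sup>+y\<in>B. p * F (\<lambda>_ _. True) y \<partial>law ?I)" .
  qed (rule F[OF Q])
  then show ?thesis
    by eventually_elim (auto simp: F_def)
qed

section \<open>Positivity of the weight and of the normalising constant
  \<open>upper_mass\<close>\<close>

definition upper_mass :: "nat \<Rightarrow> nat \<Rightarrow> real \<Rightarrow> ennreal" where
  "upper_mass k n t = (\<integral>\<^sup>+x. indicator {x. t < \<phi> x} x * tail_weight k n (\<phi> x) \<partial>M)"

lemma measurable_upper_mass[measurable]: "upper_mass k n \<in> borel_measurable borel"
proof -
  have "(\<lambda>t. \<integral>\<^sup>+x. of_bool (t < \<phi> x) * tail_weight k n (\<phi> x) \<partial>M) \<in> borel_measurable borel"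
    unfolding of_bool_def by measurable
  then show ?thesis by (simp add: upper_mass_def[abs_def] indicator_def[abs_def])
qed

text \<open>If the weight vanishes on \<open>Z\<close>, almost no tail completes a first entry from
  \<open>Z\<close>. So tuples over \<open>{k..n}\<close> with all entries in \<open>Z\<close> are
  almost never increasing, and \<open>null_if_never_increasing\<close> applies.\<close>

lemma AE_tail_weight_pos:
  assumes "k \<le> n"
  shows "AE x in M. tail_weight k n (\<phi> x) \<noteq> 0"
proof -
  let ?J = "{k..n}" and ?K = "{k+1..n}"
  define Z where "Z = {x \<in> space M. tail_weight k n (\<phi> x) = 0}"
  have Z[measurable]: "Z \<in> sets M" unfolding Z_def by measurable
  have J: "?J = insert k ?K" using assms by auto
  define E where "E = {x \<in> space (law ?J). increasing \<phi> ?J x \<and> x k \<in> Z}"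
  have [measurable]: "(\<lambda>x. x k) \<in> law ?J \<rightarrow>\<^sub>M M"
    by (rule measurable_component_singleton) (use assms in auto)
  have E: "E \<in> sets (law ?J)" unfolding E_def by measurable
  then have E': "E \<in> sets (law (insert k ?K))" by (simp only: J)
  have "emeasure (law ?J) E = (\<integral>\<^sup>+x. indicator E x \<partial>law (insert k ?K))"
    using E' by (simp only: J nn_integral_indicator)
  also have "\<dots> = (\<integral>\<^sup>+x. \<integral>\<^sup>+z. indicator E (z(k := x)) \<partial>law ?K \<partial>M)"
    by (rule factors.product_nn_integral_insert_rev) (use E' in auto)
  also have "\<dots> = (\<integral>\<^sup>+x. 0 \<partial>M)"
  proof (rule nn_integral_cong)
    fix x assume x: "x \<in> space M"
    let ?T = "{z \<in> space (law ?K). increasing \<phi> ?K z \<and> (\<forall>j\<in>?K. \<phi> x < \<phi> (z j))}"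
    have T[measurable]: "?T \<in> sets (law ?K)"
    proof -
      have [measurable]: "Measurable.pred (law ?K) (\<lambda>z. \<forall>j\<in>?K. \<phi> x < \<phi> (z j))"
        by (intro pred_intros_finite) measurable
      show ?thesis by measurable
    qed
    have "(\<integral>\<^sup>+z. indicator E (z(k := x)) \<partial>law ?K) \<le> (\<integral>\<^sup>+z. indicator Z x * (indicator ?T z :: ennreal) \<partial>law ?K)"
    proof (rule nn_integral_mono)
      fix z assume z: "z \<in> space (law ?K)"
      have "z \<in> ?T" if "increasing \<phi> ?J (z(k := x))"
      proof -
        have less: "\<phi> ((z(k := x)) i) < \<phi> ((z(k := x)) j)" if "i \<in> ?J" "j \<in> ?J" "i < j" for i j
          using \<open>increasing \<phi> ?J (z(k := x))\<close> that unfolding increasing_def by blast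
        have "\<phi> (z i) < \<phi> (z j)" if "i \<in> ?K" "j \<in> ?K" "i < j" for i j
          using less[of i j] that by simp
        moreover have "\<phi> x < \<phi> (z j)" if "j \<in> ?K" for j
          using less[of k j] that by simp
        ultimately show ?thesis using z by (simp add: increasing_def)
      qed
      then show "indicator E (z(k := x)) \<le> indicator Z x * (indicator ?T z :: ennreal)"
        by (auto simp: E_def indicator_def)
    qed
    also have "\<dots> = indicator Z x * tail_weight k n (\<phi> x)"
      using T by (simp add: nn_integral_cmult tail_weight_def)
    also have "\<dots> = 0"
      by (auto simp: Z_def indicator_def)
    finally show "(\<integral>\<^sup>+z. indicator E (z(k := x)) \<partial>law ?K) = 0" by simp
  qed
  finally have "AE x in law ?J. x \<notin> E"
    using E by (intro AE_not_in) (simp add: null_sets_def)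
  then have "AE x in law ?J. (\<forall>i\<in>?J. x i \<in> Z) \<longrightarrow> \<not> increasing \<phi> ?J x"
    using AE_space by eventually_elim (use assms in \<open>auto simp: E_def\<close>)
  then have "emeasure M Z = 0"
    by (rule null_if_never_increasing[OF Z assms])
  then have "AE x in M. x \<notin> Z"
    using Z by (intro AE_not_in) (simp add: null_sets_def)
  then show ?thesis
    using AE_space by eventually_elim (auto simp: Z_def)
qed

text \<open>As the weight is positive, a zero of \<open>upper_mass\<close> has a key that almost no
  other key exceeds. Two independent points of this kind would be tied.\<close>

lemma AE_upper_mass_pos:
  assumes "k \<le> n"
  shows "AE y in M. upper_mass k n (\<phi> y) \<noteq> 0"
proof -
  define Z where "Z = {y \<in> space M. upper_mass k n (\<phi> y) = 0}"
  have Z[measurable]: "Z \<in> sets M" unfolding Z_def by measurable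
  have top: "AE x in M. \<not> \<phi> y < \<phi> x" if "y \<in> Z" for y
  proof -
    have "AE x in M. indicator {x. \<phi> y < \<phi> x} x * tail_weight k n (\<phi> x) = 0"
    proof (subst nn_integral_0_iff_AE[symmetric])
      have "(\<lambda>x. of_bool (\<phi> y < \<phi> x) * tail_weight k n (\<phi> x)) \<in> borel_measurable M"
        unfolding of_bool_def by measurable
      then show "(\<lambda>x. indicator {x. \<phi> y < \<phi> x} x * tail_weight k n (\<phi> x)) \<in> borel_measurable M"
        by (simp add: indicator_def[abs_def])
    qed (use that in \<open>simp add: Z_def upper_mass_def\<close>)
    then show ?thesis
      using AE_tail_weight_pos[OF assms] by eventually_elim (auto simp: indicator_def split: if_splits)
  qed
  have 1: "AE y in M. AE x in M. y \<in> Z \<longrightarrow> \<not> \<phi> y < \<phi> x"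
  proof (rule AE_I2)
    fix y
    show "AE x in M. y \<in> Z \<longrightarrow> \<not> \<phi> y < \<phi> x"
      by (cases "y \<in> Z") (simp_all add: top)
  qed
  have 2: "AE y in M. AE x in M. x \<in> Z \<longrightarrow> \<not> \<phi> x < \<phi> y"
    by (rule AE_swap[OF _ 1]) measurable
  have "AE y in M. AE x in M. y \<in> Z \<longrightarrow> x \<notin> Z"
    using 1 2 tie_free
  proof eventually_elim
    case (elim y)
    then show ?case by eventually_elim auto
  qed
  then have "AE y in M. y \<notin> Z"
  \<comment> \<open>If \<open>Z\<close> is not null, no \<open>y\<close> in \<open>Z\<close>
    satisfies the preceding statement, so almost every \<open>y\<close> lies outside
    \<open>Z\<close> after all.\<close>
  proof (cases "AE y in M. y \<notin> Z")
    case False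
    then have *: "\<not> (AE x in M. y \<in> Z \<longrightarrow> x \<notin> Z)" if "y \<in> Z" for y using that by simp
    assume "AE y in M. AE x in M. y \<in> Z \<longrightarrow> x \<notin> Z"
    then show ?thesis by eventually_elim (use * in blast)
  qed
  then show ?thesis
    using AE_space by eventually_elim (auto simp: Z_def)
qed

end

subsection \<open>The fraction of later mass to the left\<close>

abbreviation (input) unit_uniform :: "real measure" where
  "unit_uniform \<equiv> uniform_measure lborel {0..1}"

lemma prob_space_unit_uniform: "prob_space unit_uniform"
  by (rule prob_space_uniform_measure) auto

lemma AE_unit_uniform: "(AE x in lborel. P x) \<Longrightarrow> AE x in unit_uniform. P x"
  by (rule AE_uniform_measureI) (auto elim: eventually_mono)

lemma AE_unit_uniform_unit: "AE x in unit_uniform. x \<in> {0..1}"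
  by (rule AE_uniform_measureI) auto

locale uniform_key = real_tie_free M \<phi> for M \<phi> +
  assumes M_eq: "M = unit_uniform"
begin

lemma emeasure_M: "A \<in> sets borel \<Longrightarrow> emeasure M A = emeasure lborel ({0..1} \<inter> A)"
  by (simp add: M_eq divide_ennreal_def)

lemma AE_M_unit: "AE x in M. x \<in> {0..1}"
  unfolding M_eq by (rule AE_unit_uniform_unit)

lemma AE_M_neq: "AE x in M. x \<noteq> a"
  using AE_not_in[of "{a}" M] by (auto simp: null_sets_def emeasure_M sets_M Int_insert_right)

lemma space_M: "space M = UNIV"
  by (simp add: M_eq)

lemma emeasure_M_interval: "0 \<le> e \<Longrightarrow> emeasure M {a..a + e} \<le> ennreal e"
proof -
  assume "0 \<le> e"
  have "emeasure M {a..a + e} \<le> emeasure lborel {a..a + e}"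
    by (subst emeasure_M) (auto intro: emeasure_mono)
  with \<open>0 \<le> e\<close> show ?thesis by simp
qed

text \<open>For a head inside an interval of length \<open>e\<close>, the middle integral is at most
  \<open>e\<close>, since the weight is at most 1. If \<open>upper_mass\<close> is at least
  \<open>d\<close> on the head and \<open>p * d > e\<close>, this contradicts \<open>mid\<close>, so
  the points of the interval with such \<open>upper_mass\<close> are null. Hence
  \<open>p > 0\<close> would force \<open>upper_mass\<close> below every positive \<open>d\<close>
  almost everywhere, against its positivity.\<close>

lemma middle_probability_zero:
  assumes k: "2 \<le> k" "k \<le> n" and "0 \<le> p"
    and mid: "AE y in law {1..k-1}. increasing \<phi> {1..k-1} y \<longrightarrow>
      (\<integral>\<^sup>+x. indicator {x. \<phi> (y (k - 1)) < \<phi> x \<and> (\<exists>i\<in>{1..k-1}. x < y i) \<and> (\<exists>i\<in>{1..k-1}. y i \<le> x)} x *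
        tail_weight k n (\<phi> x) \<partial>M) = ennreal p * upper_mass k n (\<phi> (y (k - 1)))"
  shows "p = 0"
proof (rule ccontr)
  assume "p \<noteq> 0"
  with \<open>0 \<le> p\<close> have p: "0 < p" by simp
  let ?I = "{1..k-1}"
  have less: "AE y in M. upper_mass k n (\<phi> y) < ennreal d" if d: "0 < d" for d
  proof -
    define V where "V = {y \<in> space M. ennreal d \<le> upper_mass k n (\<phi> y)}"
    have [measurable]: "V \<in> sets M" unfolding V_def by measurable
    \<comment> \<open>Any length strictly between 0 and \<open>p * d\<close> would serve.\<close>
    define e where "e = p * d / 2"
    have e: "0 < e" "e < p * d" using p d by (auto simp: e_def)
    have null: "emeasure M (V \<inter> {a..a + e}) = 0" for a
    proof (rule null_if_never_increasing)
      show "1 \<le> k - 1" using k by simp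
      show "AE y in law ?I. (\<forall>i\<in>?I. y i \<in> V \<inter> {a..a + e}) \<longrightarrow> \<not> increasing \<phi> ?I y"
        using mid
      proof eventually_elim
        case (elim y)
        show ?case
        proof (intro impI notI)
          assume in': "\<forall>i\<in>?I. y i \<in> V \<inter> {a..a + e}" and inc: "increasing \<phi> ?I y"
          have "ennreal (p * d) = ennreal p * ennreal d"
            using p d by (simp add: ennreal_mult)
          also have "\<dots> \<le> ennreal p * upper_mass k n (\<phi> (y (k - 1)))"
            using in' k by (intro mult_left_mono) (auto simp: V_def)
          also have "\<dots> = (\<integral>\<^sup>+x. indicator {x. \<phi> (y (k - 1)) < \<phi> x \<and> (\<exists>i\<in>?I. x < y i) \<and> (\<exists>i\<in>?I. y i \<le> x)} x *
              tail_weight k n (\<phi> x) \<partial>M)"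
            using elim inc by simp
          also have "\<dots> \<le> (\<integral>\<^sup>+x. indicator {a..a + e} x \<partial>M)"
          proof (rule nn_integral_mono)
            fix x
            have "x \<in> {a..a + e}" if "\<exists>i\<in>?I. x < y i" "\<exists>i\<in>?I. y i \<le> x"
            proof -
              from that obtain i j where "i \<in> ?I" "x < y i" "j \<in> ?I" "y j \<le> x" by blast
              moreover have "y i \<le> a + e" "a \<le> y j" using in' calculation by auto
              ultimately show ?thesis by simp
            qed
            then show "indicator {x. \<phi> (y (k - 1)) < \<phi> x \<and> (\<exists>i\<in>?I. x < y i) \<and> (\<exists>i\<in>?I. y i \<le> x)} x *
              tail_weight k n (\<phi> x) \<le> indicator {a..a + e} x"
              using tail_weight_le_1[of k n "\<phi> x"] by (auto simp: indicator_def)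
          qed
          also have "\<dots> \<le> ennreal e"
            using emeasure_M_interval[of e a] e by (simp add: sets_M)
          finally show False using e by (simp add: ennreal_le_iff)
        qed
      qed
    qed (simp add: sets_M)
    have "AE y in M. \<forall>m::nat. y \<notin> V \<inter> {m * e..m * e + e}"
    proof (subst AE_all_countable, rule allI)
      fix m :: nat
      show "AE y in M. y \<notin> V \<inter> {m * e..m * e + e}"
        using null[of "m * e"] by (intro AE_not_in) (auto simp: null_sets_def sets_M)
    qed
    then show ?thesis
      using AE_M_unit AE_space
    proof eventually_elim
      case (elim y)
      \<comment> \<open>Index of the grid cell of width \<open>e\<close> that contains
        \<open>y\<close>; it is a natural number because \<open>y\<close> is nonnegative.\<close>
      define m where "m = nat \<lfloor>y / e\<rfloor>"
      have "real m \<le> y / e" "y / e < real m + 1"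
        using elim(2) e unfolding m_def by (auto simp: of_nat_nat)
      then have "y \<in> {m * e..m * e + e}"
        using e by (auto simp: field_simps)
      with elim have "y \<notin> V" by blast
      with elim show ?case by (auto simp: V_def not_le)
    qed
  qed
  have "AE y in M. \<forall>m::nat. upper_mass k n (\<phi> y) < ennreal (1 / (m + 1))"
    by (subst AE_all_countable) (auto intro!: less)
  moreover have "AE y in M. upper_mass k n (\<phi> y) \<noteq> 0"
    by (rule AE_upper_mass_pos[OF k(2)])
  ultimately have "AE y in M. False"
  proof eventually_elim
    case (elim y)
    from elim(1) have "upper_mass k n (\<phi> y) < ennreal (1 / (real 0 + 1))" by blast
    with elim(2) obtain r where r: "upper_mass k n (\<phi> y) = ennreal r" "0 < r"
      by (cases "upper_mass k n (\<phi> y)") (auto simp: less_le top_unique)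
    obtain m :: nat where "1 / (real m + 1) < r"
      using reals_Archimedean[OF r(2)] by (auto simp: inverse_eq_divide add.commute)
    moreover have "ennreal r < ennreal (1 / (real m + 1))"
      using elim(1) r(1) by simp
    ultimately show False
      using r(2) by (simp add: ennreal_less_iff)
  qed
  then show False by simp
qed

text \<open>Once the middle integral vanishes, lying left of the last head entry is almost the same
  as lying left of all head entries. So \<open>low\<close> becomes a statement about the last entry
  alone, and \<open>null_if_never_increasing\<close> transfers it to almost every point.\<close>

lemma AE_lower_fraction:
  assumes k: "2 \<le> k" "k \<le> n" and "0 \<le> p"
    and mid: "AE y in law {1..k-1}. increasing \<phi> {1..k-1} y \<longrightarrow>
      (\<integral>\<^sup>+x. indicator {x. \<phi> (y (k - 1)) < \<phi> x \<and> (\<exists>i\<in>{1..k-1}. x < y i) \<and> (\<exists>i\<in>{1..k-1}. y i \<le> x)} x *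
        tail_weight k n (\<phi> x) \<partial>M) = ennreal p * upper_mass k n (\<phi> (y (k - 1)))"
    and low: "AE y in law {1..k-1}. increasing \<phi> {1..k-1} y \<longrightarrow>
      (\<integral>\<^sup>+x. indicator {x. \<phi> (y (k - 1)) < \<phi> x \<and> (\<forall>i\<in>{1..k-1}. x < y i)} x *
        tail_weight k n (\<phi> x) \<partial>M) = c * upper_mass k n (\<phi> (y (k - 1)))"
  shows "AE y in M. (\<integral>\<^sup>+x. indicator {x. \<phi> y < \<phi> x \<and> x < y} x * tail_weight k n (\<phi> x) \<partial>M) =
    c * upper_mass k n (\<phi> y)"
proof -
  let ?I = "{1..k-1}"
  have p: "p = 0" using middle_probability_zero assms by blast
  define L where "L y = (\<integral>\<^sup>+x. indicator {x. \<phi> y < \<phi> x \<and> x < y} x * tail_weight k n (\<phi> x) \<partial>M)" for y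
  have L[measurable]: "L \<in> borel_measurable M"
  proof -
    have "(\<lambda>y. \<integral>\<^sup>+x. of_bool (\<phi> y < \<phi> x \<and> x < y) * tail_weight k n (\<phi> x) \<partial>M) \<in> borel_measurable M"
      unfolding of_bool_def by measurable
    then show ?thesis by (simp add: L_def[abs_def] indicator_def[abs_def])
  qed
  define Z where "Z = {y \<in> space M. L y \<noteq> c * upper_mass k n (\<phi> y)}"
  have Z: "Z \<in> sets M" unfolding Z_def by measurable
  have "emeasure M Z = 0"
  proof (rule null_if_never_increasing[OF Z])
    show "1 \<le> k - 1" using k by simp
    show "AE y in law ?I. (\<forall>i\<in>?I. y i \<in> Z) \<longrightarrow> \<not> increasing \<phi> ?I y"
      using mid low
    proof eventually_elim
      case (elim y)
      show ?case
      proof (intro impI notI)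
        assume in': "\<forall>i\<in>?I. y i \<in> Z" and inc: "increasing \<phi> ?I y"
        let ?v = "y (k - 1)"
        let ?mid = "\<lambda>x. indicator {x. \<phi> ?v < \<phi> x \<and> (\<exists>i\<in>?I. x < y i) \<and> (\<exists>i\<in>?I. y i \<le> x)} x * tail_weight k n (\<phi> x)"
        let ?low = "\<lambda>x. indicator {x. \<phi> ?v < \<phi> x \<and> (\<forall>i\<in>?I. x < y i)} x * tail_weight k n (\<phi> x)"
        have last: "k - 1 \<in> ?I" using k by auto
        have [measurable]: "?mid \<in> borel_measurable M" "?low \<in> borel_measurable M"
        proof -
          have [measurable]: "Measurable.pred M (\<lambda>x. \<exists>i\<in>?I. x < y i)" "Measurable.pred M (\<lambda>x. \<exists>i\<in>?I. y i \<le> x)"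
            "Measurable.pred M (\<lambda>x. \<forall>i\<in>?I. x < y i)"
            by (intro pred_intros_finite; measurable)+
          show "?mid \<in> borel_measurable M" "?low \<in> borel_measurable M"
            by (simp_all add: indicator_def[abs_def] of_bool_def)
        qed
        have "(\<integral>\<^sup>+x. ?low x \<partial>M) \<le> L ?v"
          unfolding L_def using last by (intro nn_integral_mono) (auto simp: indicator_def)
        moreover have "L ?v \<le> (\<integral>\<^sup>+x. ?low x + ?mid x \<partial>M)"
          unfolding L_def
        proof (rule nn_integral_mono)
          fix x
          \<comment> \<open>A point to the left of the last entry is left of all entries, or has
            entries on both sides and is counted by the middle integral.\<close>
          have "(\<forall>i\<in>?I. x < y i) \<or> (\<exists>i\<in>?I. x < y i) \<and> (\<exists>i\<in>?I. y i \<le> x)" if "x < ?v"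
            using that last by (meson not_less)
          then show "indicator {x. \<phi> ?v < \<phi> x \<and> x < ?v} x * tail_weight k n (\<phi> x) \<le> ?low x + ?mid x"
            by (auto simp: indicator_def)
        qed
        moreover have "(\<integral>\<^sup>+x. ?low x + ?mid x \<partial>M) = (\<integral>\<^sup>+x. ?low x \<partial>M) + (\<integral>\<^sup>+x. ?mid x \<partial>M)"
          by (rule nn_integral_add) measurable
        ultimately have "L ?v = c * upper_mass k n (\<phi> ?v)"
          using elim inc p by simp
        then show False using in' last by (auto simp: Z_def)
      qed
    qed
  qed
  then have "AE y in M. y \<notin> Z"
    using Z by (intro AE_not_in) (simp add: null_sets_def)
  then show ?thesis
    using AE_space by eventually_elim (auto simp: Z_def L_def)
qed

end

subsection \<open>Balance at the quantile\<close>

context tie_free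
begin

lemma integrable_bounded:
  fixes f :: "'a \<Rightarrow> real"
  assumes "f \<in> borel_measurable M" "\<And>x. \<bar>f x\<bar> \<le> B"
  shows "integrable M f"
  using assms by (intro integrable_const_bound[where B = B]) auto

text \<open>The integral of \<open>h \<otimes> h\<close> splits into two equal halves along the ordering of the keys.\<close>

lemma integral_square_eq:
  fixes h :: "'a \<Rightarrow> real"
  assumes h[measurable]: "h \<in> borel_measurable M" and bound: "\<And>x. \<bar>h x\<bar> \<le> B"
  shows "(\<integral>x. h x \<partial>M)\<^sup>2 = 2 * (\<integral>y. h y * (\<integral>x. of_bool (\<phi> y < \<phi> x) * h x \<partial>M) \<partial>M)"
proof -
  interpret P: pair_prob_space M M ..
  have int_h: "integrable M h" by (rule integrable_bounded[OF h bound])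
  have B: "0 \<le> B" using bound[of undefined] by linarith
  define f where "f = (\<lambda>(y, x). h y * h x)"
  define g where "g = (\<lambda>(y, x). of_bool (\<phi> y < \<phi> x) * (h y * h x))"
  define g' where "g' = (\<lambda>(y, x). of_bool (\<phi> x < \<phi> y) * (h y * h x))"
  have [measurable]: "f \<in> borel_measurable (M \<Otimes>\<^sub>M M)" "g \<in> borel_measurable (M \<Otimes>\<^sub>M M)" "g' \<in> borel_measurable (M \<Otimes>\<^sub>M M)"
    unfolding f_def g_def g'_def of_bool_def by measurable
  have hh: "\<bar>h y * h x\<bar> \<le> B * B" for x y
    unfolding abs_mult by (intro mult_mono bound B) auto
  have int: "integrable (M \<Otimes>\<^sub>M M) f" "integrable (M \<Otimes>\<^sub>M M) g" "integrable (M \<Otimes>\<^sub>M M) g'"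
    using hh B by (intro P.P.integrable_const_bound[where B = "B * B"]; auto simp: f_def g_def g'_def)+
  have "(\<integral>x. h x \<partial>M)\<^sup>2 = (\<integral>y. \<integral>x. f (y, x) \<partial>M \<partial>M)"
    by (simp add: f_def power2_eq_square)
  also have "\<dots> = (\<integral>z. f z \<partial>(M \<Otimes>\<^sub>M M))"
    by (rule P.integral_fst'[OF int(1)])
  also have "\<dots> = (\<integral>z. g z + g' z \<partial>(M \<Otimes>\<^sub>M M))"
  proof (rule integral_cong_AE)
    show "AE z in M \<Otimes>\<^sub>M M. f z = g z + g' z"
      using AE_pair_tie_free by eventually_elim (auto simp: f_def g_def g'_def)
  qed measurable
  also have "\<dots> = (\<integral>z. g z \<partial>(M \<Otimes>\<^sub>M M)) + (\<integral>z. g' z \<partial>(M \<Otimes>\<^sub>M M))"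
    by (rule Bochner_Integration.integral_add[OF int(2,3)])
  also have "(\<integral>z. g z \<partial>(M \<Otimes>\<^sub>M M)) = (\<integral>y. \<integral>x. g (y, x) \<partial>M \<partial>M)"
    by (rule P.integral_fst'[OF int(2), symmetric])
  also have "(\<integral>z. g' z \<partial>(M \<Otimes>\<^sub>M M)) = (\<integral>x. \<integral>y. g' (y, x) \<partial>M \<partial>M)"
    using P.integral_snd[of "\<lambda>y x. g' (y, x)"] int(3) by simp
  also have "(\<integral>x. \<integral>y. g' (y, x) \<partial>M \<partial>M) = (\<integral>y. \<integral>x. g (y, x) \<partial>M \<partial>M)"
    by (simp add: g_def g'_def mult.commute)
  also have "(\<integral>y. \<integral>x. g (y, x) \<partial>M \<partial>M) = (\<integral>y. h y * (\<integral>x. of_bool (\<phi> y < \<phi> x) * h x \<partial>M) \<partial>M)"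
    by (intro Bochner_Integration.integral_cong refl)
      (simp add: g_def mult.left_commute[of "of_bool _"] flip: integral_mult_right_zero)
  finally show ?thesis by simp
qed

end

context uniform_key
begin

text \<open>The weight is at most 1 and \<open>M\<close> is uniform, so the cumulative weight is
  1-Lipschitz in \<open>\<theta>\<close>. It runs from 0 to the total on \<open>[0,1]\<close>, and
  the intermediate value theorem applies.\<close>

lemma ex_weighted_quantile:
  fixes w :: "real \<Rightarrow> real"
  assumes w[measurable]: "w \<in> borel_measurable M" and w01: "\<And>x. 0 \<le> w x" "\<And>x. w x \<le> 1"
    and c: "0 \<le> c" "c \<le> 1"
  shows "\<exists>\<theta>\<in>{0..1}. (\<integral>x. of_bool (x \<le> \<theta>) * w x \<partial>M) = c * (\<integral>x. w x \<partial>M)"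
proof -
  define G where "G t = (\<integral>x. of_bool (x \<le> t) * w x \<partial>M)" for t
  have [measurable]: "(\<lambda>x. of_bool (x \<le> t) * w x) \<in> borel_measurable M" for t
    unfolding of_bool_def by measurable
  have int: "integrable M (\<lambda>x. of_bool (x \<le> t) * w x)" for t
    by (rule integrable_bounded[where B = 1]) (auto simp: w01)
  have int_w: "integrable M w"
    by (rule integrable_bounded[where B = 1]) (auto simp: w01)
  have lip: "\<bar>G t - G s\<bar> \<le> t - s" if "s \<le> t" for s t
  proof -
    have [measurable]: "{s..s + (t - s)} \<in> sets M" by (simp add: sets_M)
    have "G t - G s = (\<integral>x. of_bool (x \<le> t) * w x - of_bool (x \<le> s) * w x \<partial>M)"
      unfolding G_def by (rule Bochner_Integration.integral_diff[OF int int, symmetric])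
    also have "\<bar>\<dots>\<bar> \<le> (\<integral>x. \<bar>of_bool (x \<le> t) * w x - of_bool (x \<le> s) * w x\<bar> \<partial>M)"
      by (rule integral_abs_bound)
    also have "\<dots> \<le> (\<integral>x. indicator {s..s + (t - s)} x \<partial>M)"
    proof (rule integral_mono)
      show "integrable M (\<lambda>x. \<bar>of_bool (x \<le> t) * w x - of_bool (x \<le> s) * w x\<bar>)"
        by (intro integrable_abs Bochner_Integration.integrable_diff int)
      show "integrable M (\<lambda>x. indicator {s..s + (t - s)} x :: real)"
        by (rule integrable_bounded[where B = 1]) (auto simp: indicator_def)
      fix x
      show "\<bar>of_bool (x \<le> t) * w x - of_bool (x \<le> s) * w x\<bar> \<le> (indicator {s..s + (t - s)} x :: real)"
        using that w01[of x] by (auto simp: indicator_def)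
    qed
    also have "\<dots> = measure M {s..s + (t - s)}" by simp
    also have "\<dots> \<le> t - s"
      using emeasure_M_interval[of "t - s" s] that by (simp add: emeasure_eq_measure)
    finally show ?thesis .
  qed
  have "continuous_on {0..1} G"
    unfolding continuous_on_iff
  proof (intro ballI allI impI)
    fix x e :: real assume "0 < e"
    moreover have "\<bar>G y - G x\<bar> \<le> \<bar>y - x\<bar>" for y
      using lip[of x y] lip[of y x] by (cases "x \<le> y") (auto simp: abs_minus_commute[of "G y"])
    ultimately show "\<exists>d>0. \<forall>y\<in>{0..1}. dist y x < d \<longrightarrow> dist (G y) (G x) < e"
      by (intro exI[of _ e]) (auto simp: dist_real_def intro: le_less_trans)
  qed
  moreover have "G 0 = 0"
  proof -
    have "AE x in M. of_bool (x \<le> 0) * w x = 0"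
      using AE_M_neq[of 0] AE_M_unit by eventually_elim auto
    then show ?thesis unfolding G_def by (intro integral_eq_zero_AE)
  qed
  moreover have "G 1 = (\<integral>x. w x \<partial>M)"
    unfolding G_def
  proof (rule integral_cong_AE)
    show "AE x in M. of_bool (x \<le> 1) * w x = w x"
      using AE_M_unit by eventually_elim auto
  qed measurable
  moreover have "0 \<le> (\<integral>x. w x \<partial>M)" by (rule Bochner_Integration.integral_nonneg) (rule w01)
  ultimately show ?thesis
    using IVT'[of G 0 "c * (\<integral>x. w x \<partial>M)" 1] c
    by (auto simp: G_def mult_left_le_one_le)
qed

text \<open>The fraction property has the moving threshold \<open>y\<close>, whereas the conclusion
  has one threshold \<open>\<theta>\<close> for all \<open>t\<close>. \<open>D t\<close> measures
  the failure of the conclusion at level \<open>t\<close>, and its sign at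
  \<open>t = \<phi> y\<close> is controlled by the position of \<open>y\<close> relative to
  \<open>\<theta>\<close>.\<close>

lemma key_balanced:
  fixes w :: "real \<Rightarrow> real"
  assumes w[measurable]: "w \<in> borel_measurable borel" and w01: "\<And>t. 0 \<le> w t" "\<And>t. w t \<le> 1"
    and c: "0 \<le> c" "c \<le> 1"
    and fraction: "AE y in M. (\<integral>x. of_bool (\<phi> y < \<phi> x \<and> x < y) * w (\<phi> x) \<partial>M) =
      c * (\<integral>x. of_bool (\<phi> y < \<phi> x) * w (\<phi> x) \<partial>M)"
  obtains \<theta> where "\<theta> \<in> {0..1}"
    "\<And>t. (\<integral>x. of_bool (t < \<phi> x \<and> x \<le> \<theta>) * w (\<phi> x) \<partial>M) = c * (\<integral>x. of_bool (t < \<phi> x) * w (\<phi> x) \<partial>M)"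
proof -
  let ?w = "\<lambda>x. w (\<phi> x)"
  from ex_weighted_quantile[of ?w c] w01 c obtain \<theta> where \<theta>: "\<theta> \<in> {0..1}"
    and quantile: "(\<integral>x. of_bool (x \<le> \<theta>) * ?w x \<partial>M) = c * (\<integral>x. ?w x \<partial>M)"
    by auto
  have int: "integrable M (\<lambda>x. of_bool (P x) * ?w x)" if [measurable]: "Measurable.pred M P" for P
    by (rule integrable_bounded[where B = 1]) (auto simp: w01 of_bool_def)
  define h where "h x = (of_bool (x \<le> \<theta>) - c) * ?w x" for x
  have h[measurable]: "h \<in> borel_measurable M" unfolding h_def of_bool_def by measurable
  have h_bound: "\<bar>h x\<bar> \<le> 1" for x
    unfolding h_def abs_mult using c w01[of "\<phi> x"] by (intro mult_le_one) auto
  define D where "D t = (\<integral>x. of_bool (t < \<phi> x) * h x \<partial>M)" for t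
  have D_eq: "D t = (\<integral>x. of_bool (t < \<phi> x \<and> x \<le> \<theta>) * ?w x \<partial>M) - c * (\<integral>x. of_bool (t < \<phi> x) * ?w x \<partial>M)" for t
  proof -
    have "D t = (\<integral>x. of_bool (t < \<phi> x \<and> x \<le> \<theta>) * ?w x - c * (of_bool (t < \<phi> x) * ?w x) \<partial>M)"
      unfolding D_def h_def by (intro Bochner_Integration.integral_cong refl) (auto simp: algebra_simps)
    also have "\<dots> = (\<integral>x. of_bool (t < \<phi> x \<and> x \<le> \<theta>) * ?w x \<partial>M) - (\<integral>x. c * (of_bool (t < \<phi> x) * ?w x) \<partial>M)"
      by (intro Bochner_Integration.integral_diff integrable_mult_right int) measurable
    finally show ?thesis by simp
  qed
  have h0: "(\<integral>x. h x \<partial>M) = 0"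
  proof -
    have "(\<integral>x. h x \<partial>M) = (\<integral>x. of_bool (x \<le> \<theta>) * ?w x - c * ?w x \<partial>M)"
      unfolding h_def by (intro Bochner_Integration.integral_cong refl) (auto simp: algebra_simps)
    also have "\<dots> = (\<integral>x. of_bool (x \<le> \<theta>) * ?w x \<partial>M) - (\<integral>x. c * ?w x \<partial>M)"
      using int[of "\<lambda>_. True"] by (intro Bochner_Integration.integral_diff integrable_mult_right int) auto
    finally show ?thesis using quantile by simp
  qed
  \<comment> \<open>With the fraction property, \<open>D (\<phi> y)\<close> compares points up to
    \<open>\<theta>\<close> with points left of \<open>y\<close>. It is nonnegative for
    \<open>y \<le> \<theta>\<close> and nonpositive for \<open>y > \<theta>\<close>, exactly like
    \<open>h y\<close>.\<close>
  have nonneg: "AE y in M. 0 \<le> h y * D (\<phi> y)"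
    using fraction
  proof eventually_elim
    case (elim y)
    have D: "D (\<phi> y) = (\<integral>x. of_bool (\<phi> y < \<phi> x \<and> x \<le> \<theta>) * ?w x \<partial>M) - (\<integral>x. of_bool (\<phi> y < \<phi> x \<and> x < y) * ?w x \<partial>M)"
      by (simp only: D_eq elim)
    show ?case
    proof (cases "y \<le> \<theta>")
      case True
      have "(\<integral>x. of_bool (\<phi> y < \<phi> x \<and> x < y) * ?w x \<partial>M) \<le> (\<integral>x. of_bool (\<phi> y < \<phi> x \<and> x \<le> \<theta>) * ?w x \<partial>M)"
        using True w01 by (intro integral_mono int) auto
      with True c w01 show ?thesis by (simp add: D h_def)
    next
      case False
      have "(\<integral>x. of_bool (\<phi> y < \<phi> x \<and> x \<le> \<theta>) * ?w x \<partial>M) \<le> (\<integral>x. of_bool (\<phi> y < \<phi> x \<and> x < y) * ?w x \<partial>M)"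
        using False w01 by (intro integral_mono int) auto
      with False c w01 show ?thesis by (simp add: D h_def mult_nonneg_nonpos)
    qed
  qed
  have D_meas[measurable]: "D \<in> borel_measurable borel"
    unfolding D_def of_bool_def by measurable
  have D_bound: "\<bar>D t\<bar> \<le> 1" for t
  proof -
    have "\<bar>D t\<bar> \<le> (\<integral>x. \<bar>of_bool (t < \<phi> x) * h x\<bar> \<partial>M)"
      unfolding D_def by (rule integral_abs_bound)
    also have "\<dots> \<le> (\<integral>x. 1 \<partial>M)"
      using h_bound by (intro integral_mono integrable_abs integrable_bounded[where B = 1]) (auto simp: of_bool_def)
    finally show ?thesis by (simp add: prob_space)
  qed
  \<comment> \<open>\<open>D (\<phi> y)\<close> is the inner integral of
    \<open>integral_square_eq\<close>, whose left side is 0 by the choice of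
    \<open>\<theta>\<close>.\<close>
  have "(\<integral>y. h y * D (\<phi> y) \<partial>M) = 0"
    using integral_square_eq[OF h h_bound] h0 by (simp add: D_def)
  moreover have "integrable M (\<lambda>y. h y * D (\<phi> y))"
    by (rule integrable_bounded[where B = 1]) (use h_bound D_bound in \<open>auto simp: abs_mult intro!: mult_le_one\<close>)
  ultimately have zero: "AE y in M. h y * D (\<phi> y) = 0"
    using integral_nonneg_eq_0_iff_AE nonneg by blast
  \<comment> \<open>The square formula is used again, for \<open>h\<close> cut off to keys above
    \<open>t\<close>. For \<open>y\<close> with key above \<open>t\<close> the cut-off does not
    change the inner integral, so the right side vanishes by \<open>zero\<close>, while the left
    side is the square of \<open>D t\<close>.\<close>
  have "D t = 0" for t
  proof -
    let ?k = "\<lambda>y. of_bool (t < \<phi> y) * h y"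
    have "(\<integral>y. ?k y \<partial>M)\<^sup>2 = 2 * (\<integral>y. ?k y * (\<integral>x. of_bool (\<phi> y < \<phi> x) * ?k x \<partial>M) \<partial>M)"
      using h_bound by (intro integral_square_eq[where B = 1]) (auto simp: of_bool_def)
    also have "(\<integral>y. ?k y * (\<integral>x. of_bool (\<phi> y < \<phi> x) * ?k x \<partial>M) \<partial>M) = 0"
    proof (rule integral_eq_zero_AE)
      show "AE y in M. ?k y * (\<integral>x. of_bool (\<phi> y < \<phi> x) * ?k x \<partial>M) = 0"
        using zero
      proof eventually_elim
        case (elim y)
        show ?case
        proof (cases "t < \<phi> y")
          case True
          then have "(\<integral>x. of_bool (\<phi> y < \<phi> x) * ?k x \<partial>M) = D (\<phi> y)"
            unfolding D_def by (intro Bochner_Integration.integral_cong refl) auto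
          with elim show ?thesis by simp
        qed simp
      qed
    qed
    finally show ?thesis by (simp add: D_def)
  qed
  with \<theta> that show ?thesis by (simp add: D_eq)
qed

text \<open>Balance at every \<open>t\<close> says that two finite measures on the key axis agree on
  all open upper rays, hence everywhere: the weighted law of the key left of \<open>\<theta>\<close>
  and \<open>c\<close> times the full weighted law. Since the weight is a function of the key and
  almost surely positive, it can be divided out.\<close>

lemma key_independent_of_side:
  fixes w :: "real \<Rightarrow> real"
  assumes w[measurable]: "w \<in> borel_measurable borel" and w01: "\<And>t. 0 \<le> w t" "\<And>t. w t \<le> 1"
    and w_pos: "AE x in M. w (\<phi> x) \<noteq> 0" and c: "0 \<le> c"
    and balanced: "\<And>t. (\<integral>x. of_bool (t < \<phi> x \<and> x \<le> \<theta>) * w (\<phi> x) \<partial>M) =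
      c * (\<integral>x. of_bool (t < \<phi> x) * w (\<phi> x) \<partial>M)"
    and f[measurable]: "f \<in> borel_measurable borel"
  shows "(\<integral>\<^sup>+x. of_bool (x \<le> \<theta>) * f (\<phi> x) \<partial>M) = ennreal c * (\<integral>\<^sup>+x. f (\<phi> x) \<partial>M)"
proof -
  have meas[measurable]: "(\<lambda>x. of_bool (P x) * w (\<phi> x)) \<in> borel_measurable M" if [measurable]: "Measurable.pred M P" for P
    unfolding of_bool_def by measurable
  have int: "integrable M (\<lambda>x. of_bool (P x) * w (\<phi> x))" if [measurable]: "Measurable.pred M P" for P
    by (rule integrable_bounded[where B = 1]) (auto simp: w01)
  have w_phi[measurable]: "(\<lambda>x. w (\<phi> x)) \<in> borel_measurable M" by measurable
  have side_meas[measurable]: "(\<lambda>x. ennreal (of_bool (x \<le> \<theta>) * w (\<phi> x))) \<in> borel_measurable M"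
    "(\<lambda>x. ennreal (c * w (\<phi> x))) \<in> borel_measurable M"
    by measurable
  define \<nu> where "\<nu> = distr (density M (\<lambda>x. ennreal (of_bool (x \<le> \<theta>) * w (\<phi> x)))) borel \<phi>"
  define \<kappa> where "\<kappa> = distr (density M (\<lambda>x. ennreal (c * w (\<phi> x)))) borel \<phi>"
  have int_\<nu>: "(\<integral>\<^sup>+s. g s \<partial>\<nu>) = (\<integral>\<^sup>+x. ennreal (of_bool (x \<le> \<theta>) * w (\<phi> x)) * g (\<phi> x) \<partial>M)"
    and int_\<kappa>: "(\<integral>\<^sup>+s. g s \<partial>\<kappa>) = (\<integral>\<^sup>+x. ennreal (c * w (\<phi> x)) * g (\<phi> x) \<partial>M)"
    if [measurable]: "g \<in> borel_measurable borel" for g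
    unfolding \<nu>_def \<kappa>_def by (simp_all add: nn_integral_distr nn_integral_density)
  have gt: "emeasure \<nu> {t<..} = ennreal (\<integral>x. of_bool (t < \<phi> x \<and> x \<le> \<theta>) * w (\<phi> x) \<partial>M)"
    "emeasure \<kappa> {t<..} = ennreal (c * (\<integral>x. of_bool (t < \<phi> x) * w (\<phi> x) \<partial>M))" for t
  proof -
    have "emeasure \<nu> {t<..} = (\<integral>\<^sup>+s. indicator {t<..} s \<partial>\<nu>)"
      by (simp add: \<nu>_def)
    also have "\<dots> = (\<integral>\<^sup>+x. ennreal (of_bool (t < \<phi> x \<and> x \<le> \<theta>) * w (\<phi> x)) \<partial>M)"
      by (subst int_\<nu>) (auto intro!: nn_integral_cong simp: indicator_def)
    also have "\<dots> = ennreal (\<integral>x. of_bool (t < \<phi> x \<and> x \<le> \<theta>) * w (\<phi> x) \<partial>M)"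
      by (intro nn_integral_eq_integral int) (auto simp: w01)
    finally show "emeasure \<nu> {t<..} = ennreal (\<integral>x. of_bool (t < \<phi> x \<and> x \<le> \<theta>) * w (\<phi> x) \<partial>M)" .
    have "emeasure \<kappa> {t<..} = (\<integral>\<^sup>+s. indicator {t<..} s \<partial>\<kappa>)"
      by (simp add: \<kappa>_def)
    also have "\<dots> = (\<integral>\<^sup>+x. ennreal (c * (of_bool (t < \<phi> x) * w (\<phi> x))) \<partial>M)"
      by (subst int_\<kappa>) (auto intro!: nn_integral_cong simp: indicator_def)
    also have "\<dots> = ennreal (\<integral>x. c * (of_bool (t < \<phi> x) * w (\<phi> x)) \<partial>M)"
      using c by (intro nn_integral_eq_integral integrable_mult_right int) (auto simp: w01)
    finally show "emeasure \<kappa> {t<..} = ennreal (c * (\<integral>x. of_bool (t < \<phi> x) * w (\<phi> x) \<partial>M))" by simp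
  qed
  have "\<nu> = \<kappa>"
  proof (rule measure_eqI_generator_eq)
    show "Int_stable (range greaterThan :: real set set)"
    proof -
      have "{a<..} \<inter> {b<..} = {max a b<..}" for a b :: real by auto
      then show ?thesis by (auto simp: Int_stable_def)
    qed
    show "sets \<nu> = sigma_sets UNIV (range greaterThan)" "sets \<kappa> = sigma_sets UNIV (range greaterThan)"
      by (simp_all add: \<nu>_def \<kappa>_def borel_Ioi)
    show "range (\<lambda>i::nat. {- real i<..}) \<subseteq> range greaterThan" by auto
    show "(\<Union>i::nat. {- real i<..}) = UNIV"
      by (auto simp: UNIV_eq_I) (metis minus_less_iff reals_Archimedean2)
    show "emeasure \<nu> {- real i<..} \<noteq> \<infinity>" for i by (simp add: gt)
    show "emeasure \<nu> S = emeasure \<kappa> S" if "S \<in> range greaterThan" for S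
      using that gt balanced by auto
  qed auto
  txt \<open>Dividing by the weight, which is a function of the key, removes it from both integrals.\<close>
  define g where "g s = inverse (ennreal (w s)) * f s" for s
  have [measurable]: "g \<in> borel_measurable borel" unfolding g_def by measurable
  have cancel: "ennreal (w s) * g s = f s" if "w s \<noteq> 0" for s
  proof -
    have "ennreal (w s) * inverse (ennreal (w s)) = 1"
      using that w01(1)[of s] ennreal_divide_self[of "ennreal (w s)"]
      by (simp add: divide_ennreal_def ennreal_eq_0_iff)
    then show ?thesis by (simp add: g_def flip: mult.assoc)
  qed
  have "(\<integral>\<^sup>+x. of_bool (x \<le> \<theta>) * f (\<phi> x) \<partial>M) = (\<integral>\<^sup>+s. g s \<partial>\<nu>)"
    unfolding int_\<nu>[OF \<open>g \<in> borel_measurable borel\<close>]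
  proof (rule nn_integral_cong_AE)
    show "AE x in M. of_bool (x \<le> \<theta>) * f (\<phi> x) = ennreal (of_bool (x \<le> \<theta>) * w (\<phi> x)) * g (\<phi> x)"
      using w_pos by eventually_elim (auto simp: cancel)
  qed
  also have "\<dots> = (\<integral>\<^sup>+x. ennreal c * f (\<phi> x) \<partial>M)"
    unfolding \<open>\<nu> = \<kappa>\<close> int_\<kappa>[OF \<open>g \<in> borel_measurable borel\<close>]
  proof (rule nn_integral_cong_AE)
    show "AE x in M. ennreal (c * w (\<phi> x)) * g (\<phi> x) = ennreal c * f (\<phi> x)"
      using w_pos by eventually_elim (use c w01 in \<open>simp add: ennreal_mult mult.assoc cancel\<close>)
  qed
  also have "\<dots> = ennreal c * (\<integral>\<^sup>+x. f (\<phi> x) \<partial>M)"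
    by (rule nn_integral_cmult) measurable
  finally show ?thesis .
qed

section \<open>Identification of the key with the travellers' map\<close>

lemma travellers_map_tie_free:
  assumes "\<theta> \<in> {0..1}"
  shows "AE y in M. AE x in M. travellers_map \<theta> x \<noteq> travellers_map \<theta> y"
proof (rule AE_I2)
  fix y
  let ?v = "travellers_map \<theta> y"
  show "AE x in M. travellers_map \<theta> x \<noteq> ?v"
    \<comment> \<open>The first two excluded points are the only candidates for a preimage of
      \<open>?v\<close> under the decreasing and the increasing branch.\<close>
    using AE_M_neq[of "\<theta> - \<theta> * ?v"] AE_M_neq[of "\<theta> + (1 - \<theta>) * ?v"] AE_M_neq[of 1] AE_M_unit
  proof eventually_elim
    case (elim x)
    show ?case
    proof
      assume v: "travellers_map \<theta> x = ?v"
      show False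
      proof (cases "\<theta> \<noteq> 0 \<and> x \<le> \<theta>")
        case True
        then have "\<theta> - \<theta> * ?v = x"
          unfolding v[symmetric] by (simp add: travellers_map_def)
        with elim show False by simp
      next
        case False
        then have "\<theta> \<noteq> 1" using elim by auto
        then have "\<theta> + (1 - \<theta>) * ?v = x"
          unfolding v[symmetric] using False by (auto simp: travellers_map_def)
        with elim show False by simp
      qed
    qed
  qed
qed

text \<open>By \<open>dom\<close> the keys grow with the distance from \<open>\<theta>\<close> on
  either side, which determines the larger keys on the side of \<open>y\<close>. Independence of the
  side fixes how the mass of all larger keys is divided between the sides. Together they give a
  linear equation for \<open>K (\<phi> y)\<close>.\<close>

lemma key_order_eq_travellers:
  fixes w :: "real \<Rightarrow> real"
  assumes w[measurable]: "w \<in> borel_measurable borel" and w01: "\<And>t. 0 \<le> w t" "\<And>t. w t \<le> 1"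
    and w_pos: "AE x in M. w (\<phi> x) \<noteq> 0" and c: "0 \<le> c" "c \<le> 1"
    and fraction: "AE y in M. (\<integral>x. of_bool (\<phi> y < \<phi> x \<and> x < y) * w (\<phi> x) \<partial>M) =
      c * (\<integral>x. of_bool (\<phi> y < \<phi> x) * w (\<phi> x) \<partial>M)"
  shows "\<exists>\<theta>\<in>{0..1}. AE y in M. AE x in M. \<phi> y < \<phi> x \<longleftrightarrow> travellers_map \<theta> y < travellers_map \<theta> x"
proof -
  obtain \<theta> where \<theta>: "\<theta> \<in> {0..1}"
    and balanced: "\<And>t. (\<integral>x. of_bool (t < \<phi> x \<and> x \<le> \<theta>) * w (\<phi> x) \<partial>M) = c * (\<integral>x. of_bool (t < \<phi> x) * w (\<phi> x) \<partial>M)"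
    using key_balanced[OF w w01 c fraction] by blast
  note side = key_independent_of_side[OF w w01 w_pos c(1) balanced]
  have [measurable]: "{..\<theta>} \<in> sets M" "{..<a} \<in> sets M" "{a<..} \<in> sets M" for a
    by (simp_all add: sets_M)
  have below: "measure M {..<a} = a" and upto: "measure M {..a} = a" and above: "measure M {a<..} = 1 - a"
    if "a \<in> {0..1}" for a
  proof -
    have "{0..1} \<inter> {..<a} = {0..<a}" "{0..1} \<inter> {..a} = {0..a}" "{0..1} \<inter> {a<..} = {a<..1}"
      using that by auto
    then show "measure M {..<a} = a" "measure M {..a} = a" "measure M {a<..} = 1 - a"
      using that by (simp_all add: measure_def emeasure_M)
  qed
  \<comment> \<open>The constant function 1 of the key turns \<open>side\<close> into the mass of
    the points up to \<open>\<theta>\<close>.\<close>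
  have "c = \<theta>"
  proof -
    have "ennreal c = (\<integral>\<^sup>+x. of_bool (x \<le> \<theta>) \<partial>M)"
      using side[of "\<lambda>_. 1"] by (simp add: emeasure_space_1)
    also have "\<dots> = (\<integral>\<^sup>+x. indicator {..\<theta>} x \<partial>M)"
      by (intro nn_integral_cong) (auto simp: indicator_def)
    also have "\<dots> = ennreal \<theta>"
      using upto[OF \<theta>] by (simp add: emeasure_eq_measure)
    finally show ?thesis using c \<theta> by simp
  qed
  define K where "K t = measure M {x. t < \<phi> x}" for t
  have [measurable]: "{x. t < \<phi> x} \<in> sets M" for t
    using measurable_sets[OF measurable_key, of "{t<..}"] by (simp add: space_M vimage_def)
  have [measurable]: "{x. t < \<phi> x \<and> x \<le> \<theta>} \<in> sets M" for t
  proof -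
    have "{x. t < \<phi> x \<and> x \<le> \<theta>} = {x. t < \<phi> x} \<inter> {..\<theta>}" by auto
    then show ?thesis by simp
  qed
  have left: "measure M {x. t < \<phi> x \<and> x \<le> \<theta>} = \<theta> * K t" for t
  proof -
    have "emeasure M {x. t < \<phi> x \<and> x \<le> \<theta>} = (\<integral>\<^sup>+x. indicator {x. t < \<phi> x \<and> x \<le> \<theta>} x \<partial>M)"
      by simp
    also have "\<dots> = (\<integral>\<^sup>+x. of_bool (x \<le> \<theta>) * indicator {t<..} (\<phi> x) \<partial>M)"
      by (intro nn_integral_cong) (auto simp: indicator_def)
    also have "\<dots> = ennreal c * (\<integral>\<^sup>+x. indicator {t<..} (\<phi> x) \<partial>M)"
      by (rule side) measurable
    also have "(\<integral>\<^sup>+x. indicator {t<..} (\<phi> x) \<partial>M) = (\<integral>\<^sup>+x. indicator {x. t < \<phi> x} x \<partial>M)"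
      by (intro nn_integral_cong) (auto simp: indicator_def)
    also have "\<dots> = ennreal (K t)"
      by (simp add: K_def emeasure_eq_measure)
    finally have "ennreal (measure M {x. t < \<phi> x \<and> x \<le> \<theta>}) = ennreal (\<theta> * K t)"
      using \<theta> by (simp add: emeasure_eq_measure \<open>c = \<theta>\<close> ennreal_mult K_def)
    then show ?thesis using \<theta> by (simp add: K_def)
  qed
  have int: "integrable M (\<lambda>x. of_bool (P x) * w (\<phi> x))" if [measurable]: "Measurable.pred M P" for P
    by (rule integrable_bounded[where B = 1]) (auto simp: w01 of_bool_def)
  \<comment> \<open>Among the points with key above \<open>\<phi> y\<close>, those left of
    \<open>y\<close> and those up to \<open>\<theta>\<close> carry the same weight, by
    \<open>fraction\<close> and \<open>balanced\<close>. One set contains the other, so their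
    difference is null because the weight is almost surely positive.\<close>
  have dom: "AE y in M. AE x in M. (y \<le> x \<and> x \<le> \<theta> \<or> \<theta> < x \<and> x < y) \<longrightarrow> \<not> \<phi> y < \<phi> x"
    using fraction
  proof eventually_elim
    case (elim y)
    let ?d = "\<lambda>x. of_bool (\<phi> y < \<phi> x \<and> x \<le> \<theta>) * w (\<phi> x) - of_bool (\<phi> y < \<phi> x \<and> x < y) * w (\<phi> x)"
    \<comment> \<open>This sign makes the integrand nonnegative whichever side of
      \<open>\<theta>\<close> contains \<open>y\<close>.\<close>
    let ?s = "if y \<le> \<theta> then 1 else - 1 :: real"
    have int_d: "integrable M ?d"
      by (intro Bochner_Integration.integrable_diff int) measurable
    have "(\<integral>x. ?d x \<partial>M) = 0"
      using elim balanced[of "\<phi> y"] int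
      by (subst Bochner_Integration.integral_diff) auto
    then have "(\<integral>x. ?s * ?d x \<partial>M) = 0" by simp
    moreover have "AE x in M. 0 \<le> ?s * ?d x"
      using w01 by (intro AE_I2) auto
    ultimately have "AE x in M. ?s * ?d x = 0"
      using integral_nonneg_eq_0_iff_AE[of M "\<lambda>x. ?s * ?d x"] int_d by (simp add: integrable_mult_right)
    then show ?case
      using w_pos by eventually_elim (auto split: if_splits)
  qed
  have dom': "AE y in M. AE x in M. (x \<le> y \<and> y \<le> \<theta> \<or> \<theta> < y \<and> y < x) \<longrightarrow> \<not> \<phi> x < \<phi> y"
    by (rule AE_swap[OF _ dom]) measurable
  have K: "AE y in M. travellers_map \<theta> y = 1 - K (\<phi> y)"
    \<comment> \<open>With \<open>y\<close> strictly between 0 and 1, the case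
      \<open>y \<le> \<theta>\<close> has \<open>\<theta> > 0\<close> and the other case has
      \<open>\<theta> < 1\<close>, so the divisions below are legitimate.\<close>
    using dom dom' tie_free AE_M_unit AE_M_neq[of 0] AE_M_neq[of 1]
  proof eventually_elim
    case (elim y)
    have y: "0 < y" "y < 1" using elim(4-6) by auto
    have order: "AE x in M. (y \<le> x \<and> x \<le> \<theta> \<or> \<theta> < x \<and> x < y \<longrightarrow> \<not> \<phi> y < \<phi> x) \<and>
      (x \<le> y \<and> y \<le> \<theta> \<or> \<theta> < y \<and> y < x \<longrightarrow> \<phi> y < \<phi> x)"
      using elim(1-3) by eventually_elim auto
    show ?case
    proof (cases "y \<le> \<theta>")
      case True
      have "measure M {x. \<phi> y < \<phi> x \<and> x \<le> \<theta>} = measure M {..<y}"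
      proof (rule finite_measure_eq_AE)
        show "AE x in M. x \<in> {x. \<phi> y < \<phi> x \<and> x \<le> \<theta>} \<longleftrightarrow> x \<in> {..<y}"
          using order by eventually_elim (use True in auto)
      qed measurable
      \<comment> \<open>Left of \<open>\<theta>\<close>, the larger keys on the own side belong to
        the points left of \<open>y\<close>, of mass \<open>y\<close>; by \<open>left\<close> this
        mass is also \<open>\<theta> * K (\<phi> y)\<close>.\<close>
      then have "y = \<theta> * K (\<phi> y)" using left[of "\<phi> y"] below[of y] y by simp
      then show ?thesis using True y by (auto simp: travellers_map_def field_simps)
    next
      case False
      have "K (\<phi> y) = measure M ({x. \<phi> y < \<phi> x \<and> x \<le> \<theta>} \<union> {y<..})"
        unfolding K_def
      proof (rule finite_measure_eq_AE)
        show "AE x in M. x \<in> {x. \<phi> y < \<phi> x} \<longleftrightarrow> x \<in> {x. \<phi> y < \<phi> x \<and> x \<le> \<theta>} \<union> {y<..}"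
          using order by eventually_elim (use False in auto)
      qed measurable
      also have "\<dots> = \<theta> * K (\<phi> y) + (1 - y)"
        using False y above[of y] by (subst finite_measure_Union) (auto simp: left)
      finally show ?thesis using False y by (auto simp: travellers_map_def field_simps)
    qed
  qed
  \<comment> \<open>\<open>K\<close> is antitone, so \<open>1 - K\<close> preserves the order of
    keys weakly. As the travellers' map has almost surely no ties, both directions become
    strict.\<close>
  have "AE y in M. AE x in M. \<phi> y < \<phi> x \<longleftrightarrow> travellers_map \<theta> y < travellers_map \<theta> x"
    using K travellers_map_tie_free[OF \<theta>]
  proof eventually_elim
    case (elim y)
    from elim(2) K show ?case
    proof eventually_elim
      case (elim x)
      have "K (\<phi> x) \<le> K (\<phi> y)" if "\<phi> y \<le> \<phi> x" 
        unfolding K_def using that by (intro finite_measure_mono) auto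
      moreover have "K (\<phi> y) \<le> K (\<phi> x)" if "\<phi> x \<le> \<phi> y" 
        unfolding K_def using that by (intro finite_measure_mono) auto
      ultimately show ?case
        using elim \<open>travellers_map \<theta> y = 1 - K (\<phi> y)\<close> by (cases "\<phi> y < \<phi> x") (auto simp: not_less)
    qed
  qed
  with \<theta> show ?thesis by blast
qed

end

subsection \<open>Independence of the initial rank\<close>

text \<open>The two extreme ranks are the events with \<open>Y k\<close> left of all earlier values
  and with none of them to its right; the remaining ranks together form the middle event. Rank 1 has
  a weak inequality because the rank counts strictly larger values.\<close>

lemma initial_rank_eq_iff:
  assumes "2 \<le> k"
  shows "initial_rank Y k \<omega> = k \<longleftrightarrow> (\<forall>i\<in>{1..k-1}. Y k \<omega> < Y i \<omega>)"
    and "initial_rank Y k \<omega> = 1 \<longleftrightarrow> (\<forall>i\<in>{1..k-1}. Y i \<omega> \<le> Y k \<omega>)"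
proof -
  have I: "{1..<k} = {1..k-1}" using assms by auto
  let ?A = "{i \<in> {1..k-1}. Y k \<omega> < Y i \<omega>}"
  have rank: "initial_rank Y k \<omega> = 1 + card ?A"
    by (simp only: initial_rank_def I)
  have "initial_rank Y k \<omega> = k \<longleftrightarrow> card ?A = card {1..k-1}"
    unfolding rank using assms by auto
  also have "\<dots> \<longleftrightarrow> ?A = {1..k-1}"
    using card_subset_eq[of "{1..k-1}" ?A] by (metis (no_types, lifting) finite_atLeastAtMost mem_Collect_eq subsetI)
  finally show "initial_rank Y k \<omega> = k \<longleftrightarrow> (\<forall>i\<in>{1..k-1}. Y k \<omega> < Y i \<omega>)" by blast
  have "initial_rank Y k \<omega> = 1 \<longleftrightarrow> ?A = {}"
    unfolding rank by simp
  then show "initial_rank Y k \<omega> = 1 \<longleftrightarrow> (\<forall>i\<in>{1..k-1}. Y i \<omega> \<le> Y k \<omega>)" by (auto simp: not_less)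
qed

lemma indep_rvs_prob:
  assumes "prob_space N" "indep_rvs N S f T g" "A \<in> sets S" "B \<in> sets T"
  shows "emeasure N (f -` A \<inter> g -` B \<inter> space N) =
    emeasure N (f -` A \<inter> space N) * emeasure N (g -` B \<inter> space N)"
proof -
  interpret N: prob_space N by fact
  have "N.prob ((f -` A \<inter> space N) \<inter> (g -` B \<inter> space N)) =
      N.prob (f -` A \<inter> space N) * N.prob (g -` B \<inter> space N)"
    using assms(2-4) unfolding indep_rvs_def by (intro N.indep_setD) auto
  moreover have "(f -` A \<inter> space N) \<inter> (g -` B \<inter> space N) = f -` A \<inter> g -` B \<inter> space N" by auto
  ultimately show ?thesis by (simp add: N.emeasure_eq_measure ennreal_mult)
qed

context uniform_key
begin

text \<open>\<open>emeasure_arrangement\<close> rewrites probabilities about \<open>Y\<close> as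
  masses of increasing tuples times \<open>n!\<close>. Independence then yields the hypothesis of
  \<open>AE_conditional_weight\<close> once the common factor \<open>n!\<close> is
  cancelled.\<close>

lemma rank_event_weight:
  assumes k: "2 \<le> k" "k \<le> n" and N: "prob_space N"
    and Y: "\<And>i. i \<in> {1..n} \<Longrightarrow> Y i \<in> borel_measurable N"
    and law_Y: "distr N (vec_space n) (\<lambda>\<omega>. \<lambda>i\<in>{1..n}. Y i \<omega>) =
      distr (law {1..n}) (vec_space n) (arrangement n (key_order \<phi>))"
    and indep: "indep_rvs N (count_space UNIV) (initial_rank Y k)
      (vec_space (k - 1)) (\<lambda>\<omega>. \<lambda>i\<in>{1..k - 1}. Y i \<omega>)"
    and Q: "Measurable.pred (law {1..k-1} \<Otimes>\<^sub>M M) (\<lambda>z. Q (fst z) (snd z))"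
    and rank: "\<And>\<omega>. initial_rank Y k \<omega> \<in> A \<longleftrightarrow> Q (\<lambda>i\<in>{1..k-1}. Y i \<omega>) (Y k \<omega>)"
  shows "AE y in law {1..k-1}. increasing \<phi> {1..k-1} y \<longrightarrow>
    (\<integral>\<^sup>+x. indicator {x. \<phi> (y (k - 1)) < \<phi> x \<and> Q y x} x * tail_weight k n (\<phi> x) \<partial>M) =
    ennreal (measure N (initial_rank Y k -` A \<inter> space N)) * upper_mass k n (\<phi> (y (k - 1)))"
  unfolding upper_mass_def
proof (rule AE_conditional_weight[OF k Q])
  interpret N: prob_space N by fact
  let ?J = "{1..n}" and ?I = "{1..k-1}"
  fix B assume B: "B \<in> sets (law ?I)"
  have transfer: "emeasure N {\<omega> \<in> space N. (\<lambda>i\<in>?I. Y i \<omega>) \<in> B \<and> R (\<lambda>i\<in>?I. Y i \<omega>) (Y k \<omega>)} =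
    of_nat (fact n) * emeasure (law ?J) {x \<in> space (law ?J). increasing \<phi> ?J x \<and>
      restrict x ?I \<in> B \<and> R (restrict x ?I) (x k)}"
    if R: "Measurable.pred (law ?I \<Otimes>\<^sub>M M) (\<lambda>z. R (fst z) (snd z))" for R
  proof -
    define C where "C = {x \<in> space (law ?J). restrict x ?I \<in> B \<and> R (restrict x ?I) (x k)}"
    have [measurable]: "(\<lambda>x. restrict x ?I) \<in> law ?J \<rightarrow>\<^sub>M law ?I"
      by (rule measurable_restrict_subset) (use k in auto)
    have [measurable]: "(\<lambda>x. x k) \<in> law ?J \<rightarrow>\<^sub>M M"
      by (rule measurable_component_singleton) (use k in auto)
    have pair: "(\<lambda>x. (restrict x ?I, x k)) \<in> law ?J \<rightarrow>\<^sub>M law ?I \<Otimes>\<^sub>M M"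
      by measurable
    have [measurable]: "Measurable.pred (law ?J) (\<lambda>x. R (restrict x ?I) (x k))"
      using measurable_compose[OF pair R] by simp
    have "C \<in> sets (law ?J)" unfolding C_def using B by measurable
    then have C: "C \<in> sets (vec_space n)" by (simp only: sets_vec_space)
    have Yv: "(\<lambda>\<omega>. \<lambda>i\<in>?J. Y i \<omega>) \<in> N \<rightarrow>\<^sub>M vec_space n"
      unfolding vec_space_def by (rule measurable_restrict) (rule Y)
    have space: "space (law ?J) = space (vec_space n)"
      by (rule sets_eq_imp_space_eq) (simp only: sets_vec_space)
    have "{\<omega> \<in> space N. (\<lambda>i\<in>?I. Y i \<omega>) \<in> B \<and> R (\<lambda>i\<in>?I. Y i \<omega>) (Y k \<omega>)} =
      (\<lambda>\<omega>. \<lambda>i\<in>?J. Y i \<omega>) -` C \<inter> space N"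
    proof -
      have "restrict (\<lambda>i\<in>?J. Y i \<omega>) ?I = (\<lambda>i\<in>?I. Y i \<omega>)" for \<omega>
        using k by (auto simp: restrict_def fun_eq_iff)
      moreover have "(\<lambda>i\<in>?J. Y i \<omega>) k = Y k \<omega>" for \<omega>
        using k by simp
      moreover have "(\<lambda>i\<in>?J. Y i \<omega>) \<in> space (law ?J)" if "\<omega> \<in> space N" for \<omega>
        unfolding space using measurable_space[OF Yv that] .
      ultimately show ?thesis by (auto simp: C_def)
    qed
    then have "emeasure N {\<omega> \<in> space N. (\<lambda>i\<in>?I. Y i \<omega>) \<in> B \<and> R (\<lambda>i\<in>?I. Y i \<omega>) (Y k \<omega>)} =
      emeasure (distr N (vec_space n) (\<lambda>\<omega>. \<lambda>i\<in>?J. Y i \<omega>)) C"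
      using emeasure_distr[OF Yv C] by simp
    also have "\<dots> = of_nat (fact n) * emeasure (law ?J) {x \<in> space (law ?J). increasing \<phi> ?J x \<and> x \<in> C}"
      unfolding law_Y by (rule emeasure_arrangement[OF C])
    also have "{x \<in> space (law ?J). increasing \<phi> ?J x \<and> x \<in> C} = {x \<in> space (law ?J). increasing \<phi> ?J x \<and>
      restrict x ?I \<in> B \<and> R (restrict x ?I) (x k)}"
      by (auto simp: C_def)
    finally show ?thesis .
  qed
  let ?p = "ennreal (measure N (initial_rank Y k -` A \<inter> space N))"
  have "of_nat (fact n) * emeasure (law ?J) {x \<in> space (law ?J). increasing \<phi> ?J x \<and>
      restrict x ?I \<in> B \<and> Q (restrict x ?I) (x k)} =
    emeasure N {\<omega> \<in> space N. (\<lambda>i\<in>?I. Y i \<omega>) \<in> B \<and> Q (\<lambda>i\<in>?I. Y i \<omega>) (Y k \<omega>)}"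
    by (rule transfer[OF Q, symmetric])
  also have "{\<omega> \<in> space N. (\<lambda>i\<in>?I. Y i \<omega>) \<in> B \<and> Q (\<lambda>i\<in>?I. Y i \<omega>) (Y k \<omega>)} =
    initial_rank Y k -` A \<inter> (\<lambda>\<omega>. \<lambda>i\<in>?I. Y i \<omega>) -` B \<inter> space N"
    using rank by auto
  also have "emeasure N \<dots> =
    emeasure N (initial_rank Y k -` A \<inter> space N) * emeasure N ((\<lambda>\<omega>. \<lambda>i\<in>?I. Y i \<omega>) -` B \<inter> space N)"
    by (rule indep_rvs_prob[OF N indep]) (use B in \<open>simp_all add: sets_vec_space\<close>)
  \<comment> \<open>The conjunct \<open>True\<close> brings the event into the form of
    \<open>transfer\<close> with the trivial predicate.\<close>
  also have "(\<lambda>\<omega>. \<lambda>i\<in>?I. Y i \<omega>) -` B \<inter> space N = {\<omega> \<in> space N. (\<lambda>i\<in>?I. Y i \<omega>) \<in> B \<and> True}"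
    by auto
  also have "emeasure N \<dots> = of_nat (fact n) *
      emeasure (law ?J) {x \<in> space (law ?J). increasing \<phi> ?J x \<and> restrict x ?I \<in> B \<and> True}"
    by (rule transfer) simp
  finally have "of_nat (fact n) * emeasure (law ?J) {x \<in> space (law ?J). increasing \<phi> ?J x \<and>
      restrict x ?I \<in> B \<and> Q (restrict x ?I) (x k)} =
    of_nat (fact n) * (?p * emeasure (law ?J) {x \<in> space (law ?J). increasing \<phi> ?J x \<and> restrict x ?I \<in> B})"
    by (simp only: N.emeasure_eq_measure mult.left_commute simp_thms)
  then show "emeasure (law ?J) {x \<in> space (law ?J). increasing \<phi> ?J x \<and>
      restrict x ?I \<in> B \<and> Q (restrict x ?I) (x k)} =
    ?p * emeasure (law ?J) {x \<in> space (law ?J). increasing \<phi> ?J x \<and> restrict x ?I \<in> B}"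
    by (subst (asm) ennreal_mult_cancel_left) (auto simp: fact_nonzero)
qed

lemma key_order_eq_travellers_if_rank_indep:
  assumes k: "k \<in> {2..n}" and N: "prob_space N"
    and Y: "\<And>i. i \<in> {1..n} \<Longrightarrow> Y i \<in> borel_measurable N"
    and law_Y: "distr N (vec_space n) (\<lambda>\<omega>. \<lambda>i\<in>{1..n}. Y i \<omega>) =
      distr (law {1..n}) (vec_space n) (arrangement n (key_order \<phi>))"
    and indep: "indep_rvs N (count_space UNIV) (initial_rank Y k)
      (vec_space (k - 1)) (\<lambda>\<omega>. \<lambda>i\<in>{1..k - 1}. Y i \<omega>)"
  shows "\<exists>\<theta>\<in>{0..1}. AE y in M. AE x in M. \<phi> y < \<phi> x \<longleftrightarrow> travellers_map \<theta> y < travellers_map \<theta> x"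
proof -
  interpret N: prob_space N by fact
  let ?I = "{1..k-1}"
  have k': "2 \<le> k" "k \<le> n" using k by auto
  note event = rank_event_weight[OF k' N Y law_Y indep]
  have [measurable]: "Measurable.pred (law ?I \<Otimes>\<^sub>M M) (\<lambda>z. snd z < fst z i)"
    "Measurable.pred (law ?I \<Otimes>\<^sub>M M) (\<lambda>z. fst z i \<le> snd z)" if "i \<in> ?I" for i
    using that by measurable
  have ex_less: "Measurable.pred (law ?I \<Otimes>\<^sub>M M) (\<lambda>z. \<exists>i\<in>?I. snd z < fst z i)"
    by (rule pred_intros_finite) measurable
  have ex_le: "Measurable.pred (law ?I \<Otimes>\<^sub>M M) (\<lambda>z. \<exists>i\<in>?I. fst z i \<le> snd z)"
    by (rule pred_intros_finite) measurable
  have all_less: "Measurable.pred (law ?I \<Otimes>\<^sub>M M) (\<lambda>z. \<forall>i\<in>?I. snd z < fst z i)"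
    by (rule pred_intros_finite) measurable
  \<comment> \<open>The fraction is the probability that \<open>Y k\<close> is smaller than all
    earlier values.\<close>
  define c where "c = measure N (initial_rank Y k -` {k} \<inter> space N)"
  have c: "0 \<le> c" "c \<le> 1" by (auto simp: c_def)
  define w where "w t = enn2real (tail_weight k n t)" for t
  have w[measurable]: "w \<in> borel_measurable borel" unfolding w_def by measurable
  have tail: "tail_weight k n t = ennreal (w t)" for t
    using tail_weight_le_1[of k n t] by (auto simp: w_def intro!: ennreal_enn2real[symmetric] elim: le_less_trans)
  have w01: "0 \<le> w t" "w t \<le> 1" for t
    using tail_weight_le_1[of k n t] unfolding tail by (simp_all add: w_def)
  have w_pos: "AE x in M. w (\<phi> x) \<noteq> 0"
    using AE_tail_weight_pos[OF k'(2)] by eventually_elim (auto simp: tail)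
  have int: "(\<integral>\<^sup>+x. indicator {x. P x} x * tail_weight k n (\<phi> x) \<partial>M) = ennreal (\<integral>x. of_bool (P x) * w (\<phi> x) \<partial>M)"
    if [measurable]: "Measurable.pred M P" for P
  proof -
    have "(\<integral>\<^sup>+x. indicator {x. P x} x * tail_weight k n (\<phi> x) \<partial>M) = (\<integral>\<^sup>+x. ennreal (of_bool (P x) * w (\<phi> x)) \<partial>M)"
      by (intro nn_integral_cong) (auto simp: indicator_def tail)
    also have "\<dots> = ennreal (\<integral>x. of_bool (P x) * w (\<phi> x) \<partial>M)"
      by (intro nn_integral_eq_integral integrable_bounded[where B = 1]) (auto simp: w01 of_bool_def)
    finally show ?thesis .
  qed
  have "AE y in M. (\<integral>\<^sup>+x. indicator {x. \<phi> y < \<phi> x \<and> x < y} x * tail_weight k n (\<phi> x) \<partial>M) =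
    ennreal c * upper_mass k n (\<phi> y)"
  proof (rule AE_lower_fraction[OF k'])
    \<comment> \<open>The middle event is the event that the rank is neither 1 nor
      \<open>k\<close>.\<close>
    show "AE y in law ?I. increasing \<phi> ?I y \<longrightarrow>
      (\<integral>\<^sup>+x. indicator {x. \<phi> (y (k - 1)) < \<phi> x \<and> (\<exists>i\<in>?I. x < y i) \<and> (\<exists>i\<in>?I. y i \<le> x)} x *
        tail_weight k n (\<phi> x) \<partial>M) =
      ennreal (measure N (initial_rank Y k -` (- {1, k}) \<inter> space N)) * upper_mass k n (\<phi> (y (k - 1)))"
    proof (rule event)
      fix \<omega>
      show "initial_rank Y k \<omega> \<in> - {1, k} \<longleftrightarrow>
        (\<exists>i\<in>?I. Y k \<omega> < (\<lambda>i\<in>?I. Y i \<omega>) i) \<and> (\<exists>i\<in>?I. (\<lambda>i\<in>?I. Y i \<omega>) i \<le> Y k \<omega>)"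
        using initial_rank_eq_iff[OF k'(1), of Y \<omega>] by (auto simp: not_le not_less)
    qed (assumption, intro pred_intros_logic ex_less ex_le)
    show "AE y in law ?I. increasing \<phi> ?I y \<longrightarrow>
      (\<integral>\<^sup>+x. indicator {x. \<phi> (y (k - 1)) < \<phi> x \<and> (\<forall>i\<in>?I. x < y i)} x *
        tail_weight k n (\<phi> x) \<partial>M) = ennreal c * upper_mass k n (\<phi> (y (k - 1)))"
      unfolding c_def
    proof (rule event)
      fix \<omega>
      show "initial_rank Y k \<omega> \<in> {k} \<longleftrightarrow> (\<forall>i\<in>?I. Y k \<omega> < (\<lambda>i\<in>?I. Y i \<omega>) i)"
        using initial_rank_eq_iff[OF k'(1), of Y \<omega>] by auto
    qed (assumption, rule all_less)
  qed simp
  then have "AE y in M. (\<integral>x. of_bool (\<phi> y < \<phi> x \<and> x < y) * w (\<phi> x) \<partial>M) =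
      c * (\<integral>x. of_bool (\<phi> y < \<phi> x) * w (\<phi> x) \<partial>M)"
  proof eventually_elim
    case (elim y)
    have "ennreal (\<integral>x. of_bool (\<phi> y < \<phi> x \<and> x < y) * w (\<phi> x) \<partial>M) =
      ennreal (c * (\<integral>x. of_bool (\<phi> y < \<phi> x) * w (\<phi> x) \<partial>M))"
      using elim c by (simp add: upper_mass_def int ennreal_mult w01)
    then show ?case
      using c w01 by (subst (asm) ennreal_inj) auto
  qed
  then show ?thesis
    by (rule key_order_eq_travellers[OF w w01 w_pos c])
qed

end

section \<open>The key of a Lebesgue measurable ordering\<close>

lemma AE_unit_uniform_pair:
  assumes "AE z in (lborel :: (real \<times> real) measure). P z"
  shows "AE u in unit_uniform. AE v in unit_uniform. P (u, v)"
proof -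
  have "AE u in lborel. AE v in lborel. P (u, v)"
    using assms lborel_pair.AE_pair[of P] unfolding lborel_prod by blast
  then show ?thesis
    by (intro AE_unit_uniform) (auto elim!: eventually_mono intro: AE_unit_uniform)
qed

lemma AE_unit_uniform_triple:
  assumes "AE z in (lborel :: (real \<times> real \<times> real) measure). P z"
  shows "AE u in unit_uniform. AE v in unit_uniform. AE w in unit_uniform. P (u, v, w)"
proof -
  have "AE u in lborel. AE z in lborel. P (u, z)"
    using assms lborel_pair.AE_pair[of P] unfolding lborel_prod by blast
  then show ?thesis
    by (intro AE_unit_uniform) (auto elim!: eventually_mono intro: AE_unit_uniform_pair)
qed

text \<open>Changing \<open>R\<close> on a null set gives a Borel set \<open>S\<close> that
  satisfies the tournament and transitivity conditions almost everywhere, so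
  \<open>ordering_representation\<close> applies to \<open>S\<close>. Its conclusion returns to
  \<open>R\<close> outside the null set.\<close>

lemma almost_total_ordering_key:
  assumes R: "almost_total_ordering R"
  obtains \<phi> where "uniform_key unit_uniform \<phi>"
    "AE z in unit_uniform \<Otimes>\<^sub>M unit_uniform. z \<in> R \<longleftrightarrow> \<phi> (fst z) < \<phi> (snd z)"
proof -
  interpret U: prob_space unit_uniform by (rule prob_space_unit_uniform)
  interpret UU: pair_sigma_finite unit_uniform unit_uniform ..
  have "R \<in> sets (completion lborel)"
    using R by (simp add: almost_total_ordering_def)
  then obtain S N N' where R_eq: "R = S \<union> N" and N: "N \<subseteq> N'" "N' \<in> null_sets lborel" and S: "S \<in> sets lborel"
    by (rule sets_completionE)
  have sets_UU: "sets (unit_uniform \<Otimes>\<^sub>M unit_uniform) = sets (borel :: (real \<times> real) measure)"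
    by (simp add: borel_prod[symmetric] cong: sets_pair_measure_cong)
  have [measurable]: "S \<in> sets (unit_uniform \<Otimes>\<^sub>M unit_uniform)" "N' \<in> sets (unit_uniform \<Otimes>\<^sub>M unit_uniform)"
    using S null_setsD2[OF N(2)] unfolding sets_UU by simp_all
  have RS: "z \<in> R \<longleftrightarrow> z \<in> S" if "z \<notin> N'" for z
    using R_eq N that by auto
  have N2: "AE u in unit_uniform. AE v in unit_uniform. (u, v) \<notin> N'"
    by (intro AE_unit_uniform_pair AE_not_in N)
  have N2': "AE u in unit_uniform. AE v in unit_uniform. (v, u) \<notin> N'"
    by (rule U.AE_swap[OF _ N2]) measurable
  have null: "AE u in unit_uniform. AE v in unit_uniform. (u, v) \<notin> A" if "A \<in> null_sets lebesgue" for A :: "(real \<times> real) set"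
    using AE_not_in[OF that] by (intro AE_unit_uniform_pair) (simp add: AE_completion_iff)
  have "AE u in unit_uniform. AE v in unit_uniform.
      (u, v) \<notin> {(u, v). u \<in> {0..1} \<and> v \<in> {0..1} \<and> (u, v) \<notin> R \<and> (v, u) \<notin> R}"
    "AE u in unit_uniform. AE v in unit_uniform.
      (u, v) \<notin> {(u, v). u \<in> {0..1} \<and> v \<in> {0..1} \<and> (u, v) \<in> R \<and> (v, u) \<in> R}"
    using R by (auto intro!: null simp only: almost_total_ordering_def)
  with AE_unit_uniform_unit N2 N2'
  have tournament: "AE u in unit_uniform. AE v in unit_uniform. (u, v) \<in> S \<longleftrightarrow> (v, u) \<notin> S"
  proof eventually_elim
    case u: (elim u)
    from AE_unit_uniform_unit u(2-5) show ?case
      by eventually_elim (use u(1) RS in auto)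
  qed
  have "AE u in unit_uniform. AE v in unit_uniform. AE w in unit_uniform.
      u \<in> {0..1} \<longrightarrow> v \<in> {0..1} \<longrightarrow> w \<in> {0..1} \<longrightarrow> (u, v) \<in> R \<longrightarrow> (v, w) \<in> R \<longrightarrow> (u, w) \<in> R"
    using R AE_unit_uniform_triple[of "\<lambda>(u, v, w). u \<in> {0..1} \<longrightarrow> v \<in> {0..1} \<longrightarrow> w \<in> {0..1} \<longrightarrow>
      (u, v) \<in> R \<longrightarrow> (v, w) \<in> R \<longrightarrow> (u, w) \<in> R"]
    by (simp add: almost_total_ordering_def)
  with AE_unit_uniform_unit N2
  have trans: "AE u in unit_uniform. AE v in unit_uniform. AE w in unit_uniform.
    (u, v) \<in> S \<longrightarrow> (v, w) \<in> S \<longrightarrow> (u, w) \<in> S"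
  proof eventually_elim
    case u: (elim u)
    from AE_unit_uniform_unit N2 u(2,3) show ?case
    proof eventually_elim
      case v: (elim v)
      from AE_unit_uniform_unit v(2,4) u(2) show ?case
        by eventually_elim (use u(1) v(1,3) RS in blast)
    qed
  qed
  define \<phi> where "\<phi> = (\<lambda>u. measure unit_uniform {w \<in> space unit_uniform. (w, u) \<in> S})"
  have rep: "\<phi> \<in> borel_measurable unit_uniform"
    "AE u in unit_uniform. AE v in unit_uniform. \<phi> u \<noteq> \<phi> v"
    "AE u in unit_uniform. AE v in unit_uniform. (u, v) \<in> S \<longleftrightarrow> \<phi> u < \<phi> v"
    unfolding \<phi>_def
    by (rule U.ordering_representation[OF \<open>S \<in> sets (unit_uniform \<Otimes>\<^sub>M unit_uniform)\<close> tournament trans])+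
  note [measurable] = rep(1)
  have "uniform_key unit_uniform \<phi>"
    by unfold_locales (use rep(1,2) in auto)
  moreover have "AE z in unit_uniform \<Otimes>\<^sub>M unit_uniform. z \<in> R \<longleftrightarrow> \<phi> (fst z) < \<phi> (snd z)"
  proof -
    have "AE z in unit_uniform \<Otimes>\<^sub>M unit_uniform. z \<in> S \<longleftrightarrow> \<phi> (fst z) < \<phi> (snd z)"
      by (rule UU.AE_pair_measure, measurable) (use rep(3) in simp)
    moreover have "AE z in unit_uniform \<Otimes>\<^sub>M unit_uniform. z \<notin> N'"
      by (rule UU.AE_pair_measure, measurable) (use N2 in simp)
    ultimately show ?thesis by eventually_elim (simp add: RS)
  qed
  ultimately show ?thesis by (rule that)
qed

subsection \<open>Main theorem\<close>

text \<open>Needed because an arrangement by a relation that is only Lebesgue measurable need not be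
  measurable before completion; it agrees almost surely with the arrangement by the key, which
  is.\<close>

lemma measurable_completion_AE:
  assumes g: "g \<in> M \<rightarrow>\<^sub>M L" and ae: "AE x in M. f x = g x" and f: "\<And>x. x \<in> space M \<Longrightarrow> f x \<in> space L"
  shows "f \<in> completion M \<rightarrow>\<^sub>M L"
proof (rule measurableI)
  fix A assume A: "A \<in> sets L"
  show "f -` A \<inter> space (completion M) \<in> sets (completion M)"
  proof (rule completion.in_sets_AE)
    show "AE x in completion M. x \<in> g -` A \<inter> space M \<longleftrightarrow> x \<in> f -` A \<inter> space (completion M)"
      by (rule AE_completion, use ae in eventually_elim) auto
    show "g -` A \<inter> space M \<in> sets (completion M)"
      using measurable_sets[OF g A] by simp
  qed simp
qed (use f in simp)

text \<open>The law of an arrangement depends only on the almost everywhere class of the relation.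
  This is applied to the given ordering and to the travellers' ordering with the same key
  \<open>\<phi>\<close>, which makes the two laws equal.\<close>

lemma (in uniform_key) distr_arrangement:
  assumes X: "(\<lambda>\<omega>. \<lambda>i\<in>{1..n}. X i \<omega>) \<in> N \<rightarrow>\<^sub>M law {1..n}"
    and law_X: "distr N (law {1..n}) (\<lambda>\<omega>. \<lambda>i\<in>{1..n}. X i \<omega>) = law {1..n}"
    and R: "AE z in M \<Otimes>\<^sub>M M. z \<in> R \<longleftrightarrow> \<phi> (fst z) < \<phi> (snd z)"
  shows "distr (completion N) (vec_space n) (\<lambda>\<omega>. arrangement n R (\<lambda>i. X i \<omega>)) =
    distr (law {1..n}) (vec_space n) (arrangement n (key_order \<phi>))"
proof -
  let ?J = "{1..n}"
  let ?g = "\<lambda>\<omega>. arrangement n (key_order \<phi>) (\<lambda>i\<in>?J. X i \<omega>)"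
  have "AE x in law ?J. \<forall>i\<in>?J. \<forall>j\<in>?J. i \<noteq> j \<longrightarrow> ((x i, x j) \<in> R \<longleftrightarrow> \<phi> (x i) < \<phi> (x j))"
    by (rule AE_PiM_pairs) (use R in simp_all)
  then have "AE x in distr N (law ?J) (\<lambda>\<omega>. \<lambda>i\<in>?J. X i \<omega>).
      \<forall>i\<in>?J. \<forall>j\<in>?J. i \<noteq> j \<longrightarrow> ((x i, x j) \<in> R \<longleftrightarrow> \<phi> (x i) < \<phi> (x j))"
    by (simp only: law_X)
  from AE_distrD[OF X this]
  have ae: "AE \<omega> in N. arrangement n R (\<lambda>i. X i \<omega>) = ?g \<omega>"
    by eventually_elim (rule arrangement_cong, auto)
  have g: "?g \<in> N \<rightarrow>\<^sub>M vec_space n"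
    by (rule measurable_compose[OF X measurable_arrangement])
  have "distr (completion N) (vec_space n) (\<lambda>\<omega>. arrangement n R (\<lambda>i. X i \<omega>)) = distr (completion N) (vec_space n) ?g"
  proof (rule distr_cong_AE)
    show "(\<lambda>\<omega>. arrangement n R (\<lambda>i. X i \<omega>)) \<in> completion N \<rightarrow>\<^sub>M vec_space n"
      by (rule measurable_completion_AE[OF g ae]) (simp add: arrangement_def vec_space_def space_PiM)
  qed (use ae g in \<open>auto intro: AE_completion measurable_completion\<close>)
  also have "\<dots> = distr N (vec_space n) ?g"
    by (rule distr_completion[OF g])
  also have "\<dots> = distr (distr N (law ?J) (\<lambda>\<omega>. \<lambda>i\<in>?J. X i \<omega>)) (vec_space n) (arrangement n (key_order \<phi>))"
    unfolding distr_distr[OF measurable_arrangement X] comp_def ..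
  finally show ?thesis by (simp only: law_X)
qed

theorem theorem3:
  fixes M :: "'a measure" and X :: "nat \<Rightarrow> 'a \<Rightarrow> real"
    and N :: "'b measure" and Y :: "nat \<Rightarrow> 'b \<Rightarrow> real"
    and n :: nat
  assumes "n \<ge> 3"
    and "prob_space M" and "prob_space N"
    and "prob_space.indep_vars M (\<lambda>_. borel) X {1..n}"
    and "\<And>i. i \<in> {1..n} \<Longrightarrow> distr M borel (X i) = uniform_measure lborel {0..1}"
    and "\<And>i. i \<in> {1..n} \<Longrightarrow> Y i \<in> borel_measurable N"
    and "binary_rearrangement M X N Y n"
    and "\<exists>k\<in>{2..n}. indep_rvs N
           (count_space UNIV) (initial_rank Y k)
           (vec_space (k - 1)) (\<lambda>\<omega>. \<lambda>i\<in>{1..k - 1}. Y i \<omega>)"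
  shows "\<exists>\<theta>\<in>{0..1}.
           distr N (vec_space n) (\<lambda>\<omega>. \<lambda>i\<in>{1..n}. Y i \<omega>) =
           distr M (vec_space n) (travellers_process n \<theta> X)"
proof -
  interpret M: prob_space M by fact
  let ?J = "{1..n}"
  have X: "X i \<in> borel_measurable M" if "i \<in> ?J" for i
    using assms(4) that by (auto simp: M.indep_vars_def)
  obtain R where R: "almost_total_ordering R"
    and law_Y: "distr N (vec_space n) (\<lambda>\<omega>. \<lambda>i\<in>?J. Y i \<omega>) =
      distr (completion M) (vec_space n) (\<lambda>\<omega>. arrangement n R (\<lambda>i. X i \<omega>))"
    using assms(7) by (auto simp: binary_rearrangement_def)
  from almost_total_ordering_key[OF R] obtain \<phi> where key: "uniform_key unit_uniform \<phi>"
    and R_key: "AE z in unit_uniform \<Otimes>\<^sub>M unit_uniform. z \<in> R \<longleftrightarrow> \<phi> (fst z) < \<phi> (snd z)" by blast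
  interpret U: uniform_key unit_uniform \<phi> by fact
  have Xv: "(\<lambda>\<omega>. \<lambda>i\<in>?J. X i \<omega>) \<in> M \<rightarrow>\<^sub>M U.law ?J"
    using X by (intro measurable_restrict) (simp add: measurable_cong_sets[OF refl U.sets_M])
  have "distr M (PiM ?J (\<lambda>_. borel)) (\<lambda>\<omega>. \<lambda>i\<in>?J. X i \<omega>) = PiM ?J (\<lambda>i. distr M borel (X i))"
    using M.indep_vars_iff_distr_eq_PiM'[where I = ?J and M' = "\<lambda>_. borel" and X = X] assms(1,4) X by auto
  also have "\<dots> = U.law ?J"
    by (intro PiM_cong refl assms(5))
  finally have law_X: "distr M (U.law ?J) (\<lambda>\<omega>. \<lambda>i\<in>?J. X i \<omega>) = U.law ?J"
    by (simp add: U.sets_M cong: distr_cong sets_PiM_cong)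
  have law_Y': "distr N (vec_space n) (\<lambda>\<omega>. \<lambda>i\<in>?J. Y i \<omega>) =
      distr (U.law ?J) (vec_space n) (arrangement n (key_order \<phi>))"
    unfolding law_Y by (rule U.distr_arrangement[OF Xv law_X R_key])
  obtain k where k: "k \<in> {2..n}" and indep: "indep_rvs N (count_space UNIV) (initial_rank Y k)
      (vec_space (k - 1)) (\<lambda>\<omega>. \<lambda>i\<in>{1..k - 1}. Y i \<omega>)"
    using assms(8) by blast
  obtain \<theta> where \<theta>: "\<theta> \<in> {0..1}"
    and order: "AE y in unit_uniform. AE x in unit_uniform. \<phi> y < \<phi> x \<longleftrightarrow> travellers_map \<theta> y < travellers_map \<theta> x"
    using U.key_order_eq_travellers_if_rank_indep[OF k assms(3,6) law_Y' indep] by blast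
  have [measurable]: "travellers_map \<theta> \<in> borel_measurable unit_uniform"
    unfolding travellers_map_def by measurable
  \<comment> \<open>This supplies the Borel measurability of the arrangement by the travellers'
    map.\<close>
  interpret T: uniform_key unit_uniform "travellers_map \<theta>"
  proof unfold_locales
    show "AE x in unit_uniform. AE y in unit_uniform. travellers_map \<theta> x \<noteq> travellers_map \<theta> y"
      using U.travellers_map_tie_free[OF \<theta>] by (simp add: eq_commute)
  qed auto
  interpret UU: pair_sigma_finite unit_uniform unit_uniform ..
  have "AE z in unit_uniform \<Otimes>\<^sub>M unit_uniform.
      travellers_map \<theta> (fst z) < travellers_map \<theta> (snd z) \<longleftrightarrow> \<phi> (fst z) < \<phi> (snd z)"
    by (rule UU.AE_pair_measure, measurable) (use order in simp, simp add: eq_commute)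
  then have "AE z in unit_uniform \<Otimes>\<^sub>M unit_uniform. z \<in> key_order (travellers_map \<theta>) \<longleftrightarrow> \<phi> (fst z) < \<phi> (snd z)"
    by (simp add: case_prod_beta)
  from U.distr_arrangement[OF Xv law_X this]
  have "distr (completion M) (vec_space n) (travellers_process n \<theta> X) =
      distr (U.law ?J) (vec_space n) (arrangement n (key_order \<phi>))"
    by (simp add: travellers_process_def[abs_def])
  \<comment> \<open>Measurability on \<open>M\<close> itself allows the completion to be dropped
    from the law of the travellers' process.\<close>
  moreover have "travellers_process n \<theta> X \<in> M \<rightarrow>\<^sub>M vec_space n"
  proof -
    have "travellers_process n \<theta> X = (\<lambda>\<omega>. arrangement n (key_order (travellers_map \<theta>)) (\<lambda>i\<in>?J. X i \<omega>))"
      unfolding travellers_process_def[abs_def] by (intro ext arrangement_cong) auto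
    then show ?thesis
      using measurable_compose[OF Xv T.measurable_arrangement] by simp
  qed
  ultimately have "distr N (vec_space n) (\<lambda>\<omega>. \<lambda>i\<in>?J. Y i \<omega>) = distr M (vec_space n) (travellers_process n \<theta> X)"
    using law_Y' by (simp add: distr_completion)
  with \<theta> show ?thesis by blast
qed

end
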